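(* Let $p\in[1,\infty)$ with $p\neq 2$. Then the Banach space $L_p=L_p([0,1],\lambda)$ ($\lambda$ being Lebesgue measure) has at least countably infinitely many pairwise non-conjugate equivalent almost transitive norms. That is, there is an infinite sequence $(\|\cdot\|_n)_{n\geq 1}$ of norms on $L_p$, each equivalent to the usual norm of $L_p$ and almost transitive, such that for $n\neq m$ the norms $\|\cdot\|_n$ and $\|\cdot\|_m$ are not conjugate.
   Context: The scalar field is $\mathbb R$ or $\mathbb C$. "Isometry" of a Banach space means linear surjective isometry. A norm $\|\cdot\|$ on a Banach space $X$ is almost transitive if for all $x,y\in X$ with $\|x\|=\|y\|=1$ and every $\varepsilon>0$ there is a surjective linear isometry $T$ of $(X,\|\cdot\|)$ with $\|y-Tx\|\leq\varepsilon$. Two equivalent norms $\|\cdot\|$ and $|\cdot|$ on a Banach space $X$ are conjugate if there is a bounded linear automorphism $T$ of $X$ with $\|x\|=|Tx|$ for all $x\in X$ (equivalently, if $(X,\|\cdot\|)$ and $(X,|\cdot|)$ are linearly isometric). *)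

theory Defs
  imports "HOL-Analysis.Analysis"
begin

abbreviation unit_interval_measure :: "real measure"  (\<open>\<lambda>\<^sub>0\<^sub>1\<close>)
  where "\<lambda>\<^sub>0\<^sub>1 \<equiv> lebesgue_on {0..1}"

definition L0_eq ::
  "(real \<Rightarrow> 'k::{real_normed_field,second_countable_topology}) \<Rightarrow> (real \<Rightarrow> 'k) \<Rightarrow> bool"
  where "L0_eq f g \<longleftrightarrow>
    f \<in> borel_measurable \<lambda>\<^sub>0\<^sub>1 \<and> g \<in> borel_measurable \<lambda>\<^sub>0\<^sub>1 \<and> (AE x in \<lambda>\<^sub>0\<^sub>1. f x = g x)"

text \<open>Elements of \<open>'k L0\<close> are a.e.-equivalence classes of measurable functions on \<open>[0,1]\<close>.
  HOL has no types depending on \<open>p\<close>, so the spaces \<open>L\<^sub>p\<close> are subsets of this type.\<close>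

quotient_type (overloaded) 'k L0 =
  "real \<Rightarrow> 'k::{real_normed_field,second_countable_topology}" / partial: L0_eq
proof (rule part_equivpI)
  show "\<exists>f::real \<Rightarrow> 'k. L0_eq f f"
    by (rule exI[of _ "\<lambda>_. 0"]) (simp add: L0_eq_def)
  show "symp (L0_eq :: (real \<Rightarrow> 'k) \<Rightarrow> _)"
    by (auto simp: symp_def L0_eq_def elim: eventually_mono)
  show "transp (L0_eq :: (real \<Rightarrow> 'k) \<Rightarrow> _)"
    unfolding transp_def L0_eq_def by (auto elim: eventually_elim2)
qed

instantiation L0 :: ("{real_normed_field,second_countable_topology}") ab_group_add
begin

lift_definition zero_L0 :: "'a L0" is "\<lambda>_. 0"
  by (simp add: L0_eq_def)

lift_definition plus_L0 :: "'a L0 \<Rightarrow> 'a L0 \<Rightarrow> 'a L0" is "\<lambda>f g x. f x + g x"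
  unfolding L0_eq_def by (auto elim: eventually_elim2)

lift_definition minus_L0 :: "'a L0 \<Rightarrow> 'a L0 \<Rightarrow> 'a L0" is "\<lambda>f g x. f x - g x"
  unfolding L0_eq_def by (auto elim: eventually_elim2)

lift_definition uminus_L0 :: "'a L0 \<Rightarrow> 'a L0" is "\<lambda>f x. - f x"
  unfolding L0_eq_def by (auto elim: eventually_mono)

instance
  by standard (transfer; auto simp: L0_eq_def add.assoc add.commute)+

end

lift_definition scale_L0 ::
  "'k::{real_normed_field,second_countable_topology} \<Rightarrow> 'k L0 \<Rightarrow> 'k L0"
  is "\<lambda>c f x. c * f x"
  unfolding L0_eq_def by (auto elim: eventually_mono)

lemma vector_space_scale_L0:
  "vector_space (scale_L0 :: 'k::{real_normed_field,second_countable_topology} \<Rightarrow> _)"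
  by standard (transfer; auto simp: L0_eq_def algebra_simps)+

lift_definition in_Lp ::
  "real \<Rightarrow> 'k::{real_normed_field,second_countable_topology} L0 \<Rightarrow> bool"
  is "\<lambda>p f. integrable \<lambda>\<^sub>0\<^sub>1 (\<lambda>x. norm (f x) powr p)"
  unfolding L0_eq_def by (intro integrable_cong_AE) (auto elim: eventually_mono)

definition Lp :: "real \<Rightarrow> 'k::{real_normed_field,second_countable_topology} L0 set"
  where "Lp p = {f. in_Lp p f}"

lift_definition Lp_norm ::
  "real \<Rightarrow> 'k::{real_normed_field,second_countable_topology} L0 \<Rightarrow> real"
  is "\<lambda>p f. (LINT x|\<lambda>\<^sub>0\<^sub>1. norm (f x) powr p) powr (1 / p)"
  unfolding L0_eq_def
  by (intro arg_cong[where f = "\<lambda>t. t powr _"] integral_cong_AE) (auto elim: eventually_mono)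

definition linear_on ::
  "'k::{real_normed_field,second_countable_topology} L0 set \<Rightarrow> ('k L0 \<Rightarrow> 'k L0) \<Rightarrow> bool"
  where "linear_on V T \<longleftrightarrow>
    (\<forall>x\<in>V. \<forall>y\<in>V. T (x + y) = T x + T y) \<and>
    (\<forall>c. \<forall>x\<in>V. T (scale_L0 c x) = scale_L0 c (T x))"

definition norm_on ::
  "'k::{real_normed_field,second_countable_topology} L0 set \<Rightarrow> ('k L0 \<Rightarrow> real) \<Rightarrow> bool"
  where "norm_on V N \<longleftrightarrow>
    (\<forall>x\<in>V. 0 \<le> N x) \<and>
    (\<forall>x\<in>V. N x = 0 \<longleftrightarrow> x = 0) \<and>
    (\<forall>c. \<forall>x\<in>V. N (scale_L0 c x) = norm c * N x) \<and>
    (\<forall>x\<in>V. \<forall>y\<in>V. N (x + y) \<le> N x + N y)"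

definition equivalent_norms_on ::
  "'k::{real_normed_field,second_countable_topology} L0 set
    \<Rightarrow> ('k L0 \<Rightarrow> real) \<Rightarrow> ('k L0 \<Rightarrow> real) \<Rightarrow> bool"
  where "equivalent_norms_on V N M \<longleftrightarrow>
    (\<exists>a>0. \<exists>b>0. \<forall>x\<in>V. a * M x \<le> N x \<and> N x \<le> b * M x)"

definition surj_linear_isometry_on ::
  "'k::{real_normed_field,second_countable_topology} L0 set
    \<Rightarrow> ('k L0 \<Rightarrow> real) \<Rightarrow> ('k L0 \<Rightarrow> 'k L0) \<Rightarrow> bool"
  where "surj_linear_isometry_on V N T \<longleftrightarrow>
    linear_on V T \<and> T ` V = V \<and> (\<forall>x\<in>V. N (T x) = N x)"

definition almost_transitive_on ::
  "'k::{real_normed_field,second_countable_topology} L0 set \<Rightarrow> ('k L0 \<Rightarrow> real) \<Rightarrow> bool"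
  where "almost_transitive_on V N \<longleftrightarrow>
    (\<forall>x\<in>V. \<forall>y\<in>V. N x = 1 \<longrightarrow> N y = 1 \<longrightarrow>
      (\<forall>\<epsilon>>0. \<exists>T. surj_linear_isometry_on V N T \<and> N (y - T x) \<le> \<epsilon>))"

text \<open>In the next two definitions \<open>B\<close> is the given norm of the Banach space \<open>V\<close>.\<close>

definition bounded_linear_automorphism_on ::
  "'k::{real_normed_field,second_countable_topology} L0 set
    \<Rightarrow> ('k L0 \<Rightarrow> real) \<Rightarrow> ('k L0 \<Rightarrow> 'k L0) \<Rightarrow> bool"
  where "bounded_linear_automorphism_on V B T \<longleftrightarrow>
    linear_on V T \<and> bij_betw T V V \<and>
    (\<exists>C. \<forall>x\<in>V. B (T x) \<le> C * B x) \<and>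
    (\<exists>C. \<forall>y\<in>V. B (inv_into V T y) \<le> C * B y)"

definition conjugate_norms_on ::
  "'k::{real_normed_field,second_countable_topology} L0 set
    \<Rightarrow> ('k L0 \<Rightarrow> real) \<Rightarrow> ('k L0 \<Rightarrow> real) \<Rightarrow> ('k L0 \<Rightarrow> real) \<Rightarrow> bool"
  where "conjugate_norms_on V B N M \<longleftrightarrow>
    (\<exists>T. bounded_linear_automorphism_on V B T \<and> (\<forall>x\<in>V. N x = M (T x)))"

end

theory Submission
  imports Defs
begin

text \<open>Cutting \<open>[0,1]\<close> into \<open>n\<close> equal pieces identifies \<open>L\<^sub>p\<close> with \<open>L\<^sub>p([0,1]; K\<^sup>n)\<close>, where \<open>K\<close> is the
  scalar field; giving \<open>K\<^sup>n\<close> its Hilbert norm yields an equivalent norm.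

  It is almost transitive: a measurable field of unitaries turns a function \<open>F\<close> into \<open>(|F|, 0, \<dots>, 0)\<close>,
  the function \<open>|F|\<close> is close to a continuous \<open>h > 0\<close> with \<open>\<integral> h\<^sup>p = 1\<close>, and \<open>G \<mapsto> h \<cdot> (G \<circ> \<phi>)\<close>
  with \<open>\<phi>(t) = \<integral>\<^sub>0\<^sup>t h\<^sup>p\<close> is a surjective isometry that sends the constant \<open>(1, 0, \<dots>, 0)\<close> to \<open>(h, 0, \<dots>, 0)\<close>.

  For \<open>p \<noteq> 2\<close> two functions have disjoint supports iff
  \<open>\<parallel>x + y\<parallel>\<^sup>p + \<parallel>x - y\<parallel>\<^sup>p = 2 (\<parallel>x\<parallel>\<^sup>p + \<parallel>y\<parallel>\<^sup>p)\<close>, so isometries preserve disjointness.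
  Hence, if an isometry from \<open>L\<^sub>p(K\<^sup>a)\<close> onto \<open>L\<^sub>p(K\<^sup>b)\<close> maps \<open>f\<^sub>c\<close> to the constant function \<open>c \<in> K\<^sup>b\<close>, then
  it maps every restriction \<open>1\<^sub>B f\<^sub>c\<close> to \<open>1\<^sub>A c\<close> with \<open>A\<close> independent of \<open>c\<close>. Therefore \<open>|f\<^sub>c(t)| = r(t) |c|\<close>
  almost everywhere, and at a point with \<open>r(t) > 0\<close> the images of the unit vectors of \<open>K\<^sup>b\<close> are
  orthogonal over the reals in \<open>K\<^sup>a\<close>, which forces \<open>b \<le> a dim K\<close>. So the dimensions
  \<open>(1 + dim K)\<^sup>k\<close> give pairwise non-conjugate norms.\<close>

section \<open>Change of variables between intervals\<close>

text \<open>Lebesgue measure is complete: subsets of null sets are measurable, so the exceptional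
  set itself can be used instead of a null set covering it.\<close>

lemma AE_lebesgue_on_iff_null:
  assumes "S \<in> sets lebesgue"
  shows "(AE x in lebesgue_on S. P x) \<longleftrightarrow> {x \<in> S. \<not> P x} \<in> null_sets lebesgue"
proof -
  have "(AE x in lebesgue_on S. P x) \<longleftrightarrow> (AE x in lebesgue. x \<in> S \<longrightarrow> P x)"
    using assms by (subst AE_restrict_space_iff) auto
  also have "\<dots> \<longleftrightarrow> {x \<in> S. \<not> P x} \<in> null_sets lebesgue"
    by (auto simp: eventually_ae_filter subset_iff
        intro: null_sets_completion_subset bexI[of _ "{x \<in> S. \<not> P x}"])
  finally show ?thesis .
qed

lemma integrable_indicator_interval:
  assumes "A \<in> sets lebesgue"
  shows "integrable (lebesgue_on {a..b::real}) (indicator A :: real \<Rightarrow> real)"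
proof -
  interpret finite_measure "lebesgue_on {a..b}"
    by (intro finite_measure_lebesgue_on) auto
  show ?thesis
    using assms by (intro integrable_const_bound[where B = 1])
      (auto simp: indicator_def intro!: borel_measurable_indicator measurable_restrict_space1)
qed

text \<open>Two kinds of maps are treated this way: the affine bijections of \<open>[0,1]\<close>
  onto its equal pieces, and the distribution function of a positive continuous density.\<close>

locale interval_diffeo =
  fixes a b a' b' :: real and \<phi> d :: "real \<Rightarrow> real"
  assumes deriv: "\<And>x. x \<in> {a..b} \<Longrightarrow> (\<phi> has_field_derivative d x) (at x within {a..b})"
    and pos: "\<And>x. x \<in> {a..b} \<Longrightarrow> d x > 0"
    and cont: "continuous_on {a..b} d"
    and bij: "bij_betw \<phi> {a..b} {a'..b'}"
begin

lemma image_eq: "\<phi> ` {a..b} = {a'..b'}" and inj: "inj_on \<phi> {a..b}"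
  using bij by (auto simp: bij_betw_def)

lemma integral_change:
  fixes f :: "real \<Rightarrow> real"
  shows "integrable (lebesgue_on {a..b}) (\<lambda>x. d x * f (\<phi> x)) \<longleftrightarrow> integrable (lebesgue_on {a'..b'}) f"
    and "integrable (lebesgue_on {a'..b'}) f \<Longrightarrow>
      (LINT x|lebesgue_on {a..b}. d x * f (\<phi> x)) = (LINT y|lebesgue_on {a'..b'}. f y)"
proof -
  let ?g = "\<lambda>x. d x * f (\<phi> x)"
  \<comment> \<open>The change of variables theorem carries the absolute value of the derivative;
    positivity of \<open>d\<close> removes it afterwards.\<close>
  have *: "(\<lambda>x. \<bar>d x\<bar> * f (\<phi> x)) absolutely_integrable_on {a..b} \<and>
      integral {a..b} (\<lambda>x. \<bar>d x\<bar> * f (\<phi> x)) = c \<longleftrightarrow>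
      f absolutely_integrable_on {a'..b'} \<and> integral {a'..b'} f = c" for c
    using has_absolute_integral_change_of_variables_1'[of "{a..b}" \<phi> d f c] deriv inj image_eq by auto
  have "(\<lambda>x. \<bar>d x\<bar> * f (\<phi> x)) absolutely_integrable_on {a..b} \<longleftrightarrow> ?g absolutely_integrable_on {a..b}"
    using pos by (intro set_integrable_cong) (auto simp: less_imp_le)
  moreover have "integral {a..b} (\<lambda>x. \<bar>d x\<bar> * f (\<phi> x)) = integral {a..b} ?g"
    using pos by (intro integral_cong) (auto simp: less_imp_le)
  ultimately have **: "?g absolutely_integrable_on {a..b} \<and> integral {a..b} ?g = c \<longleftrightarrow>
      f absolutely_integrable_on {a'..b'} \<and> integral {a'..b'} f = c" for c
    using * by metis
  then show 1: "integrable (lebesgue_on {a..b}) ?g \<longleftrightarrow> integrable (lebesgue_on {a'..b'}) f"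
    by (auto simp: integrable_restrict_space set_integrable_def)
  assume f: "integrable (lebesgue_on {a'..b'}) f"
  with 1 show "(LINT x|lebesgue_on {a..b}. ?g x) = (LINT y|lebesgue_on {a'..b'}. f y)"
    using ** by (simp add: lebesgue_integral_eq_integral)
      (metis f integrable_restrict_space set_integrable_def sets.Int_space_eq2 lborelD lborelD_Collect lmeasurable_interval(1) fmeasurableD)
qed

lemma d_integrable: "integrable (lebesgue_on {a..b}) d"
  using cont by (simp add: continuous_imp_integrable_real)

text \<open>Measurability is read off from the change of variables. The pulled back indicator of
  \<open>A\<close>, weighted with \<open>d > 0\<close>, is integrable, and the set where it is
  positive is the preimage. Conversely, restricting \<open>d\<close> to a measurable preimage gives
  an integrable function, so the indicator of \<open>A\<close> is integrable.\<close>

lemma preimage_sets: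
  assumes "A \<subseteq> {a'..b'}"
  shows "{x \<in> {a..b}. \<phi> x \<in> A} \<in> sets lebesgue \<longleftrightarrow> A \<in> sets lebesgue"
proof
  assume "A \<in> sets lebesgue"
  then have "integrable (lebesgue_on {a'..b'}) (indicator A :: real \<Rightarrow> real)"
    by (rule integrable_indicator_interval)
  then have "(\<lambda>x. d x * indicator A (\<phi> x)) \<in> borel_measurable (lebesgue_on {a..b})"
    by (subst (asm) integral_change(1)[symmetric]) auto
  then have "{x \<in> space (lebesgue_on {a..b}). d x * indicator A (\<phi> x) > 0} \<in> sets (lebesgue_on {a..b})"
    by measurable
  also have "{x \<in> space (lebesgue_on {a..b}). d x * indicator A (\<phi> x) > 0} = {x \<in> {a..b}. \<phi> x \<in> A}"
    using pos by (auto simp: indicator_def zero_less_mult_iff)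
  finally show "{x \<in> {a..b}. \<phi> x \<in> A} \<in> sets lebesgue"
    by (simp add: sets_restrict_space_iff)
next
  let ?B = "{x \<in> {a..b}. \<phi> x \<in> A}"
  assume B: "?B \<in> sets lebesgue"
  then have "?B \<in> sets (lebesgue_on {a..b})" by (auto simp: sets_restrict_space_iff)
  then have "integrable (lebesgue_on {a..b}) (\<lambda>x. indicator ?B x *\<^sub>R d x)"
    using d_integrable by (intro integrable_mult_indicator)
  also have "?this \<longleftrightarrow> integrable (lebesgue_on {a..b}) (\<lambda>x. d x * indicator A (\<phi> x))"
    by (intro Bochner_Integration.integrable_cong) (auto simp: indicator_def)
  finally have "(indicator A :: real \<Rightarrow> real) \<in> borel_measurable (lebesgue_on {a'..b'})"
    by (subst (asm) integral_change(1)) auto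
  then have "A \<inter> space (lebesgue_on {a'..b'}) \<in> sets (lebesgue_on {a'..b'})"
    by (simp add: borel_measurable_indicator_iff)
  then show "A \<in> sets lebesgue"
    using assms by (auto simp: sets_restrict_space_iff Int_absorb2)
qed

lemma borel_measurable_comp_iff:
  fixes f :: "real \<Rightarrow> 'b::topological_space"
  shows "(\<lambda>x. f (\<phi> x)) \<in> borel_measurable (lebesgue_on {a..b}) \<longleftrightarrow> f \<in> borel_measurable (lebesgue_on {a'..b'})"
proof -
  have "(\<lambda>x. f (\<phi> x)) -` U \<inter> {a..b} \<in> sets lebesgue \<longleftrightarrow> f -` U \<inter> {a'..b'} \<in> sets lebesgue" for U
  proof -
    have "(\<lambda>x. f (\<phi> x)) -` U \<inter> {a..b} = {x \<in> {a..b}. \<phi> x \<in> f -` U \<inter> {a'..b'}}"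
      using image_eq by auto
    then show ?thesis using preimage_sets[of "f -` U \<inter> {a'..b'}"] by simp
  qed
  then show ?thesis
    by (auto simp: measurable_def sets_restrict_space_iff)
qed

text \<open>A measurable set is null iff its indicator has integral zero, and the weight
  \<open>d > 0\<close> does not change where the pulled back indicator vanishes. If the exceptional
  sets are not measurable, both sides fail.\<close>

lemma AE_comp_iff:
  "(AE x in lebesgue_on {a..b}. P (\<phi> x)) \<longleftrightarrow> (AE y in lebesgue_on {a'..b'}. P y)"
proof -
  let ?A = "{y \<in> {a'..b'}. \<not> P y}"
  let ?B = "{x \<in> {a..b}. \<phi> x \<in> ?A}"
  have Beq: "?B = {x \<in> {a..b}. \<not> P (\<phi> x)}" using image_eq by auto
  have sets: "?B \<in> sets lebesgue \<longleftrightarrow> ?A \<in> sets lebesgue" by (intro preimage_sets) auto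
  have "?B \<in> null_sets lebesgue \<longleftrightarrow> ?A \<in> null_sets lebesgue" if A: "?A \<in> sets lebesgue"
  proof -
    have B: "?B \<in> sets lebesgue" using A sets by simp
    have iA: "integrable (lebesgue_on {a'..b'}) (indicator ?A :: real \<Rightarrow> real)"
      using A by (rule integrable_indicator_interval)
    have iB: "integrable (lebesgue_on {a..b}) (\<lambda>x. d x * indicator ?A (\<phi> x))"
      using integral_change(1) iA by blast
    have "?A \<in> null_sets lebesgue \<longleftrightarrow> (AE y in lebesgue_on {a'..b'}. (indicator ?A y :: real) = 0)"
    proof -
      have "{y \<in> {a'..b'}. (indicator ?A y :: real) \<noteq> 0} = ?A" by (auto simp: indicator_def)
      then show ?thesis by (simp only: AE_lebesgue_on_iff_null lborelD sets_completionI_sets atLeastAtMost_borel sets_lborel)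
    qed
    also have "\<dots> \<longleftrightarrow> (LINT y|lebesgue_on {a'..b'}. (indicator ?A y :: real)) = 0"
      using iA by (subst integral_nonneg_eq_0_iff_AE) auto
    also have "\<dots> \<longleftrightarrow> (LINT x|lebesgue_on {a..b}. d x * indicator ?A (\<phi> x)) = 0"
      by (simp only: integral_change(2)[OF iA])
    also have "\<dots> \<longleftrightarrow> (AE x in lebesgue_on {a..b}. d x * indicator ?A (\<phi> x) = 0)"
      using iB pos by (intro integral_nonneg_eq_0_iff_AE) (auto intro!: AE_I2 mult_nonneg_nonneg simp: less_imp_le)
    also have "\<dots> \<longleftrightarrow> ?B \<in> null_sets lebesgue"
    proof -
      have "{x \<in> {a..b}. d x * indicator ?A (\<phi> x) \<noteq> 0} = ?B"
        using pos by (auto simp: indicator_def less_le)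
      then show ?thesis by (simp only: AE_lebesgue_on_iff_null lborelD sets_completionI_sets atLeastAtMost_borel sets_lborel)
    qed
    finally show ?thesis ..
  qed
  then have "?B \<in> null_sets lebesgue \<longleftrightarrow> ?A \<in> null_sets lebesgue"
    using sets by blast
  then show ?thesis unfolding Beq
    by (simp only: AE_lebesgue_on_iff_null lborelD sets_completionI_sets atLeastAtMost_borel sets_lborel)
qed

end

section \<open>Coordinates on equal pieces of the unit interval\<close>

lemma rep_L0_measurable [measurable]: "rep_L0 x \<in> borel_measurable \<lambda>\<^sub>0\<^sub>1"
  using Quotient3_rep_reflp[OF Quotient3_L0, of x] by (simp add: L0_eq_def)

lemma rep_abs_L0:
  assumes "f \<in> borel_measurable \<lambda>\<^sub>0\<^sub>1"
  shows "AE t in \<lambda>\<^sub>0\<^sub>1. rep_L0 (abs_L0 f) t = f t"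
  using Quotient3_rep_abs[OF Quotient3_L0, of f] assms by (simp add: L0_eq_def)

lemma L0_eq_iff: "x = y \<longleftrightarrow> (AE t in \<lambda>\<^sub>0\<^sub>1. rep_L0 x t = rep_L0 y t)"
  using Quotient3_rel_rep[OF Quotient3_L0, of x y] by (simp add: L0_eq_def)

lemma rep_L0_arith:
  shows rep_L0_zero: "AE t in \<lambda>\<^sub>0\<^sub>1. rep_L0 0 t = 0"
    and rep_L0_add: "AE t in \<lambda>\<^sub>0\<^sub>1. rep_L0 (x + y) t = rep_L0 x t + rep_L0 y t"
    and rep_L0_diff: "AE t in \<lambda>\<^sub>0\<^sub>1. rep_L0 (x - y) t = rep_L0 x t - rep_L0 y t"
    and rep_L0_scale: "AE t in \<lambda>\<^sub>0\<^sub>1. rep_L0 (scale_L0 c x) t = c * rep_L0 x t"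
  unfolding zero_L0_def plus_L0_def minus_L0_def scale_L0_def map_fun_def comp_def id_def
  by (rule rep_abs_L0; measurable)+

lemma piece_diffeo:
  assumes "n > 0"
  shows "interval_diffeo 0 1 (real i / real n) ((1 + real i) / real n) (\<lambda>t. (t + real i) / real n) (\<lambda>_. 1 / real n)"
proof
  show "((\<lambda>t. (t + real i) / real n) has_real_derivative 1 / real n) (at x within {0..1})" for x
    using assms by (auto intro!: derivative_eq_intros)
  show "bij_betw (\<lambda>t. (t + real i) / real n) {0..1} {real i / real n..(1 + real i) / real n}"
    using assms
    by (intro bij_betwI[where g = "\<lambda>t. t * real n - real i"]) (auto simp: field_simps)
qed (use assms in auto)

lemma unit_interval_pieces:
  assumes "n > 0"
  shows "{0..1} = (\<Union>i<n. {real i / real n..(1 + real i) / real n})"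
proof (intro equalityI subsetI)
  fix x :: real assume x: "x \<in> {0..1}"
  show "x \<in> (\<Union>i<n. {real i / real n..(1 + real i) / real n})"
  proof (cases "x = 1")
    case True
    \<comment> \<open>The right endpoint lies in the last closed piece, whereas the floor used below
      would give the index \<open>n\<close>.\<close>
    then show ?thesis using assms by (auto intro!: bexI[of _ "n - 1"] simp: field_simps of_nat_diff)
  next
    case False
    let ?i = "nat \<lfloor>real n * x\<rfloor>"
    have 1: "real ?i \<le> real n * x" "real n * x < real ?i + 1"
      using x by (auto simp: of_nat_nat)
    have "real n * x < real n" using x False assms by simp
    then have "?i < n" using 1 by linarith
    then show ?thesis using 1 assms by (auto intro!: bexI[of _ ?i] simp: field_simps)
  qed
next
  fix x assume "x \<in> (\<Union>i<n. {real i / real n..(1 + real i) / real n})"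
  then obtain i where i: "i < n" "real i / real n \<le> x" "x \<le> (1 + real i) / real n" by auto
  have "(1 + real i) / real n \<le> 1" "real i / real n \<ge> 0" using i(1) by (auto simp: field_simps)
  then show "x \<in> {0..1}" using i(2,3) unfolding atLeastAtMost_iff by linarith
qed

lemma piece_subset:
  assumes "i < n"
  shows "{real i / real n..(1 + real i) / real n} \<subseteq> {0..1}"
  using unit_interval_pieces[of n] assms by auto

text \<open>The exceptional set is the finite union of its parts in the pieces, and each part is
  null iff its preimage under the affine map is. The overlap of the closed pieces does no harm
  here.\<close>

lemma AE_pieces:
  assumes "n > 0"
  shows "(AE x in \<lambda>\<^sub>0\<^sub>1. P x) \<longleftrightarrow> (\<forall>i<n. AE t in \<lambda>\<^sub>0\<^sub>1. P ((t + real i) / real n))"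
proof -
  let ?J = "\<lambda>i. {real i / real n..(1 + real i) / real n}"
  have "(AE t in \<lambda>\<^sub>0\<^sub>1. P ((t + real i) / real n)) \<longleftrightarrow> {x \<in> ?J i. \<not> P x} \<in> null_sets lebesgue" for i
    using interval_diffeo.AE_comp_iff[OF piece_diffeo[OF assms], of P i]
    by (simp only: AE_lebesgue_on_iff_null lborelD sets_completionI_sets atLeastAtMost_borel sets_lborel)
  moreover have "{x \<in> {0..1}. \<not> P x} = (\<Union>i<n. {x \<in> ?J i. \<not> P x})"
    using unit_interval_pieces[OF assms] by blast
  moreover have "(\<Union>i<n. {x \<in> ?J i. \<not> P x}) \<in> null_sets lebesgue \<longleftrightarrow>
      (\<forall>i<n. {x \<in> ?J i. \<not> P x} \<in> null_sets lebesgue)"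
    by (auto intro: null_sets_UN' null_sets_completion_subset[rotated])
  ultimately show ?thesis
    by (simp only: AE_lebesgue_on_iff_null lborelD sets_completionI_sets atLeastAtMost_borel sets_lborel)
qed

lemma measurable_pieces:
  fixes f :: "real \<Rightarrow> 'b::topological_space"
  assumes "n > 0"
  shows "f \<in> borel_measurable \<lambda>\<^sub>0\<^sub>1 \<longleftrightarrow>
    (\<forall>i<n. (\<lambda>t. f ((t + real i) / real n)) \<in> borel_measurable \<lambda>\<^sub>0\<^sub>1)"
proof -
  let ?J = "\<lambda>i. {real i / real n..(1 + real i) / real n}"
  have 1: "(\<lambda>t. f ((t + real i) / real n)) \<in> borel_measurable \<lambda>\<^sub>0\<^sub>1 \<longleftrightarrow> f \<in> borel_measurable (lebesgue_on (?J i))" for i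
    by (rule interval_diffeo.borel_measurable_comp_iff[OF piece_diffeo[OF assms]])
  have 2: "f \<in> borel_measurable (lebesgue_on S) \<longleftrightarrow> (\<forall>U. U \<in> sets borel \<longrightarrow> f -` U \<inter> S \<in> sets lebesgue)"
    if "S \<in> sets lebesgue" for S
    using that by (auto simp: measurable_def sets_restrict_space_iff)
  have "f -` U \<inter> {0..1} \<in> sets lebesgue \<longleftrightarrow> (\<forall>i<n. f -` U \<inter> ?J i \<in> sets lebesgue)" for U
  proof -
    have "f -` U \<inter> {0..1} = (\<Union>i<n. f -` U \<inter> ?J i)"
      using unit_interval_pieces[OF assms] by blast
    moreover have "f -` U \<inter> ?J i = (f -` U \<inter> {0..1}) \<inter> ?J i" if "i < n" for i
      using piece_subset[OF that] by blast
    then have "f -` U \<inter> ?J i \<in> sets lebesgue" if "i < n" "f -` U \<inter> {0..1} \<in> sets lebesgue" for i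
      using that by (metis sets.Int sets_completionI_sets atLeastAtMost_borel sets_lborel)
    ultimately show ?thesis by (metis (no_types, lifting) sets.finite_UN finite_lessThan lessThan_iff)
  qed
  then show ?thesis
    unfolding 1 using 2[of "{0..1}"] 2[of "?J _"] by auto
qed

lemma integral_pieces:
  fixes f :: "real \<Rightarrow> real"
  assumes "n > 0"
  shows "integrable \<lambda>\<^sub>0\<^sub>1 f \<longleftrightarrow> (\<forall>i<n. integrable \<lambda>\<^sub>0\<^sub>1 (\<lambda>t. f ((t + real i) / real n)))"
    and "integrable \<lambda>\<^sub>0\<^sub>1 f \<Longrightarrow>
      (LINT x|\<lambda>\<^sub>0\<^sub>1. f x) = (\<Sum>i<n. LINT t|\<lambda>\<^sub>0\<^sub>1. f ((t + real i) / real n)) / real n"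
proof -
  let ?J = "\<lambda>i. {real i / real n..(1 + real i) / real n}"
  let ?f = "\<lambda>i t. f ((t + real i) / real n)"
  have J: "set_integrable lebesgue (?J i) f \<longleftrightarrow> integrable \<lambda>\<^sub>0\<^sub>1 (?f i)" for i
  proof -
    have "integrable \<lambda>\<^sub>0\<^sub>1 (?f i) \<longleftrightarrow> integrable \<lambda>\<^sub>0\<^sub>1 (\<lambda>t. 1 / real n * ?f i t)"
      using assms by (simp only: integrable_mult_left_iff) simp
    also have "\<dots> \<longleftrightarrow> integrable (lebesgue_on (?J i)) f"
      by (rule interval_diffeo.integral_change(1)[OF piece_diffeo[OF assms]])
    also have "\<dots> \<longleftrightarrow> set_integrable lebesgue (?J i) f"
      unfolding set_integrable_def by (rule integrable_restrict_space) simp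
    finally show ?thesis ..
  qed
  have U: "integrable \<lambda>\<^sub>0\<^sub>1 f \<longleftrightarrow> set_integrable lebesgue (\<Union>i<n. ?J i) f"
    unfolding unit_interval_pieces[OF assms, symmetric]
    by (simp add: integrable_restrict_space set_integrable_def)
  show "integrable \<lambda>\<^sub>0\<^sub>1 f \<longleftrightarrow> (\<forall>i<n. integrable \<lambda>\<^sub>0\<^sub>1 (?f i))"
    unfolding U J[symmetric] by (auto intro!: set_integrable_UN intro: set_integrable_subset)
  assume "integrable \<lambda>\<^sub>0\<^sub>1 f"
  then have fJ: "set_integrable lebesgue (?J i) f" if "i < n" for i
    unfolding U using that by (auto intro: set_integrable_subset)
  \<comment> \<open>Distinct closed pieces meet at most in an endpoint, which makes the integral
    additive over their union.\<close>
  have ov: "AE x in lebesgue. x \<in> ?J i \<and> x \<in> ?J j \<longrightarrow> i = j" for i j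
  proof -
    have "x \<in> {real i / real n, real j / real n}" if "x \<in> ?J i" "x \<in> ?J j" "i \<noteq> j" for x
    proof -
      have *: "real i \<le> x * n" "x * n \<le> 1 + real i" "real j \<le> x * n" "x * n \<le> 1 + real j"
        using that assms by (auto simp: field_simps)
      then have "x * n = real i \<or> x * n = real j" using \<open>i \<noteq> j\<close> by linarith
      then show ?thesis using assms by (auto simp: field_simps)
    qed
    then have "{x \<in> space lebesgue. \<not> (x \<in> ?J i \<and> x \<in> ?J j \<longrightarrow> i = j)} \<subseteq> {real i / real n, real j / real n}"
      by blast
    moreover have "{real i / real n, real j / real n} \<in> null_sets lebesgue"
      by (simp add: null_sets_completionI finite_imp_null_set_lborel)
    ultimately show ?thesis by (intro AE_I')
  qed
  have "(LINT x|\<lambda>\<^sub>0\<^sub>1. f x) = (LINT x:(\<Union>i<n. ?J i)|lebesgue. f x)"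
    unfolding unit_interval_pieces[OF assms, symmetric]
    by (simp add: integral_restrict_space set_lebesgue_integral_def)
  also have "\<dots> = (\<Sum>i<n. LINT x:?J i|lebesgue. f x)"
    using ov fJ by (intro set_integral_finite_UN_AE) auto
  also have "\<dots> = (\<Sum>i<n. LINT t|\<lambda>\<^sub>0\<^sub>1. 1 / real n * ?f i t)"
  proof (rule sum.cong)
    fix i assume "i \<in> {..<n}"
    then have "integrable (lebesgue_on (?J i)) f" using fJ[of i]
      by (simp add: integrable_restrict_space set_integrable_def)
    then show "(LINT x:?J i|lebesgue. f x) = (LINT t|\<lambda>\<^sub>0\<^sub>1. 1 / real n * ?f i t)"
      by (subst interval_diffeo.integral_change(2)[OF piece_diffeo[OF assms]])
         (simp_all add: integral_restrict_space set_lebesgue_integral_def)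
  qed auto
  also have "\<dots> = (\<Sum>i<n. LINT t|\<lambda>\<^sub>0\<^sub>1. ?f i t) / real n"
    by (simp add: sum_divide_distrib)
  finally show "(LINT x|\<lambda>\<^sub>0\<^sub>1. f x) = (\<Sum>i<n. LINT t|\<lambda>\<^sub>0\<^sub>1. ?f i t) / real n" .
qed

section \<open>Passage between classes on the interval and \<open>n\<close>-tuples of
  functions\<close>

definition coord :: "nat \<Rightarrow> 'k::{real_normed_field,second_countable_topology} L0 \<Rightarrow> nat \<Rightarrow> real \<Rightarrow> 'k"
  where "coord n x i t = rep_L0 x ((t + real i) / real n)"

text \<open>At \<open>t = 1\<close> the index is \<open>n\<close>, which is out of range; this affects a null set only.\<close>

definition glue :: "nat \<Rightarrow> (nat \<Rightarrow> real \<Rightarrow> 'k) \<Rightarrow> real \<Rightarrow> 'k::{real_normed_field,second_countable_topology}"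
  where "glue n F t = F (nat \<lfloor>real n * t\<rfloor>) (frac (real n * t))"

definition glue_L0 :: "nat \<Rightarrow> (nat \<Rightarrow> real \<Rightarrow> 'k) \<Rightarrow> 'k::{real_normed_field,second_countable_topology} L0"
  where "glue_L0 n F = abs_L0 (glue n F)"

lemma AE_not_one: "AE t in \<lambda>\<^sub>0\<^sub>1. t \<noteq> 1"
proof -
  have "{t \<in> {0..1}. \<not> (t::real) \<noteq> 1} = {1}" by auto
  then have "{t \<in> {0..1}. \<not> (t::real) \<noteq> 1} \<in> null_sets lebesgue" by (simp only:) simp
  then show ?thesis by (subst AE_lebesgue_on_iff_null) auto
qed

lemma glue_piece:
  assumes "n > 0" "0 \<le> t" "t < 1"
  shows "glue n F ((t + real i) / real n) = F i t"
proof -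
  have "real n * ((t + real i) / real n) = t + real i" using assms by simp
  moreover have "\<lfloor>t + real i\<rfloor> = int i" using assms by linarith
  ultimately show ?thesis by (simp add: glue_def frac_def)
qed

lemma AE_glue_piece:
  assumes "n > 0"
  shows "AE t in \<lambda>\<^sub>0\<^sub>1. glue n F ((t + real i) / real n) = F i t"
  using AE_not_one AE_space by eventually_elim (auto intro!: glue_piece[OF assms])

lemma glue_measurable:
  assumes n: "n > 0" and F: "\<And>i. i < n \<Longrightarrow> F i \<in> borel_measurable \<lambda>\<^sub>0\<^sub>1"
  shows "glue n F \<in> borel_measurable \<lambda>\<^sub>0\<^sub>1"
proof (subst measurable_pieces[OF n], intro allI impI)
  fix i assume i: "i < n"
  have [measurable]: "F i \<in> borel_measurable \<lambda>\<^sub>0\<^sub>1" by (rule F[OF i])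
  \<comment> \<open>At \<open>t = 1\<close> the glued function takes its value from the next piece.
    Prescribing that single value separately gives equality at every point of the space, as
    \<open>measurable_cong\<close> demands.\<close>
  have "(\<lambda>t. if t = 1 then glue n F ((1 + real i) / real n) else F i t) \<in> borel_measurable \<lambda>\<^sub>0\<^sub>1"
  proof (rule measurable_If)
    have "{x \<in> space \<lambda>\<^sub>0\<^sub>1. x = 1} = {1}" by auto
    then show "{x \<in> space \<lambda>\<^sub>0\<^sub>1. x = 1} \<in> sets \<lambda>\<^sub>0\<^sub>1"
      by (simp add: sets_restrict_space_iff)
  qed auto
  also have "?this \<longleftrightarrow> (\<lambda>t. glue n F ((t + real i) / real n)) \<in> borel_measurable \<lambda>\<^sub>0\<^sub>1"
    by (rule measurable_cong) (auto simp: glue_piece[OF n])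
  finally show "(\<lambda>t. glue n F ((t + real i) / real n)) \<in> borel_measurable \<lambda>\<^sub>0\<^sub>1" .
qed

lemma coord_measurable:
  assumes "i < n" shows "coord n x i \<in> borel_measurable \<lambda>\<^sub>0\<^sub>1"
  using measurable_pieces[of n "rep_L0 x"] assms unfolding coord_def[abs_def] by auto

lemma coord_glue_L0:
  assumes "i < n" and F: "\<And>i. i < n \<Longrightarrow> F i \<in> borel_measurable \<lambda>\<^sub>0\<^sub>1"
  shows "AE t in \<lambda>\<^sub>0\<^sub>1. coord n (glue_L0 n F) i t = F i t"
proof -
  have n: "n > 0" using assms by simp
  have "AE t in \<lambda>\<^sub>0\<^sub>1. rep_L0 (glue_L0 n F) t = glue n F t"
    unfolding glue_L0_def by (intro rep_abs_L0 glue_measurable n F)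
  then have "AE t in \<lambda>\<^sub>0\<^sub>1. coord n (glue_L0 n F) i t = glue n F ((t + real i) / real n)"
    unfolding coord_def by (rule iffD1[OF AE_pieces[OF n], rule_format, OF _ assms(1)])
  then show ?thesis using AE_glue_piece[OF n, of F i] by eventually_elim simp
qed

lemma L0_eq_iff_coord:
  assumes "n > 0"
  shows "x = y \<longleftrightarrow> (\<forall>i<n. AE t in \<lambda>\<^sub>0\<^sub>1. coord n x i t = coord n y i t)"
  unfolding L0_eq_iff coord_def by (rule AE_pieces[OF assms])

text \<open>Coordinates are taken from the chosen representatives \<open>rep_L0\<close>, which
  respect the operations only up to null sets.\<close>

lemma coord_arith:
  assumes "i < n"
  shows coord_zero: "AE t in \<lambda>\<^sub>0\<^sub>1. coord n 0 i t = 0"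
    and coord_add: "AE t in \<lambda>\<^sub>0\<^sub>1. coord n (x + y) i t = coord n x i t + coord n y i t"
    and coord_diff: "AE t in \<lambda>\<^sub>0\<^sub>1. coord n (x - y) i t = coord n x i t - coord n y i t"
    and coord_scale: "AE t in \<lambda>\<^sub>0\<^sub>1. coord n (scale_L0 c x) i t = c * coord n x i t"
proof -
  have n: "n > 0" using assms by simp
  note * = iffD1[OF AE_pieces[OF n], rule_format, OF _ assms]
  show "AE t in \<lambda>\<^sub>0\<^sub>1. coord n 0 i t = 0"
    and "AE t in \<lambda>\<^sub>0\<^sub>1. coord n (x + y) i t = coord n x i t + coord n y i t"
    and "AE t in \<lambda>\<^sub>0\<^sub>1. coord n (x - y) i t = coord n x i t - coord n y i t"
    and "AE t in \<lambda>\<^sub>0\<^sub>1. coord n (scale_L0 c x) i t = c * coord n x i t"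
    unfolding coord_def by (rule *[OF rep_L0_zero] *[OF rep_L0_add] *[OF rep_L0_diff] *[OF rep_L0_scale])+
qed

lemma L0_integral_coord:
  assumes "n > 0"
  shows "integrable \<lambda>\<^sub>0\<^sub>1 (\<lambda>t. norm (rep_L0 x t) powr p) \<longleftrightarrow>
      (\<forall>i<n. integrable \<lambda>\<^sub>0\<^sub>1 (\<lambda>t. norm (coord n x i t) powr p))"
    and "integrable \<lambda>\<^sub>0\<^sub>1 (\<lambda>t. norm (rep_L0 x t) powr p) \<Longrightarrow>
      (LINT t|\<lambda>\<^sub>0\<^sub>1. norm (rep_L0 x t) powr p) = (\<Sum>i<n. LINT t|\<lambda>\<^sub>0\<^sub>1. norm (coord n x i t) powr p) / real n"
  using integral_pieces[OF assms, of "\<lambda>t. norm (rep_L0 x t) powr p"] by (simp_all add: coord_def)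

lemma Lp_iff_rep: "x \<in> Lp p \<longleftrightarrow> integrable \<lambda>\<^sub>0\<^sub>1 (\<lambda>t. norm (rep_L0 x t) powr p)"
  and Lp_norm_rep: "Lp_norm p x = (LINT t|\<lambda>\<^sub>0\<^sub>1. norm (rep_L0 x t) powr p) powr (1 / p)"
  by (simp_all add: Lp_def in_Lp_def Lp_norm_def)

section \<open>The mixed norms\<close>

text \<open>Convexity of the power on the closed half-line. If \<open>u\<close> or \<open>v\<close>
  is zero, the claim reduces to \<open>m powr p \<le> m\<close> for \<open>m\<close> between 0 and
  1; otherwise it is convexity on the open half-line.\<close>

lemma powr_convex_combination:
  fixes u v l p :: real
  assumes "0 \<le> u" "0 \<le> v" "0 \<le> l" "l \<le> 1" "1 \<le> p"
  shows "(l * u + (1 - l) * v) powr p \<le> l * u powr p + (1 - l) * v powr p"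
proof -
  have small: "m powr p \<le> m" if "0 \<le> m" "m \<le> 1" for m :: real
    using powr_mono'[of 1 p m] that assms by auto
  consider "u = 0" | "v = 0" | "u > 0" "v > 0" using assms by linarith
  then show ?thesis
  proof cases
    case 1
    then show ?thesis using small[of "1 - l"] assms by (simp add: powr_mult mult_right_mono)
  next
    case 2
    then show ?thesis using small[of l] assms by (simp add: powr_mult mult_right_mono)
  next
    case 3
    then show ?thesis
      using convex_onD[OF powr_convex[OF assms(5)], of "1 - l" u v] assms by (simp add: algebra_simps)
  qed
qed

text \<open>For \<open>a\<close> and \<open>b\<close> above the two norms, \<open>f + g\<close> is
  \<open>a + b\<close> times the convex combination of \<open>f / a\<close> and \<open>g / b\<close>
  with weights \<open>a / (a + b)\<close> and \<open>b / (a + b)\<close>. Convexity of the power is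
  applied pointwise and then integrated.\<close>

lemma Minkowski_powr:
  fixes f g :: "'a \<Rightarrow> real"
  assumes p: "1 \<le> p" and f0: "\<And>t. 0 \<le> f t" and g0: "\<And>t. 0 \<le> g t"
    and [measurable]: "f \<in> borel_measurable M" "g \<in> borel_measurable M"
    and f: "integrable M (\<lambda>t. f t powr p)" and g: "integrable M (\<lambda>t. g t powr p)"
  shows "integrable M (\<lambda>t. (f t + g t) powr p)"
    and "(LINT t|M. (f t + g t) powr p) powr (1 / p) \<le>
      (LINT t|M. f t powr p) powr (1 / p) + (LINT t|M. g t powr p) powr (1 / p)"
proof -
  let ?A = "(LINT t|M. f t powr p) powr (1 / p)" and ?B = "(LINT t|M. g t powr p) powr (1 / p)"
  have pt: "(f t + g t) powr p \<le> (a + b) powr p * (a / (a + b) * (f t powr p / a powr p) + b / (a + b) * (g t powr p / b powr p))"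
    if "a > 0" "b > 0" for a b t
  proof -
    have w: "1 - a / (a + b) = b / (a + b)" using that by (simp add: field_simps)
    have "f t + g t = (a + b) * (a / (a + b) * (f t / a) + b / (a + b) * (g t / b))"
      using that by (simp add: distrib_left)
    then have "f t + g t = (a + b) * (a / (a + b) * (f t / a) + (1 - a / (a + b)) * (g t / b))"
      by (simp only: w)
    also have "\<dots> powr p = (a + b) powr p * (a / (a + b) * (f t / a) + (1 - a / (a + b)) * (g t / b)) powr p"
      using that f0 g0 by (intro powr_mult)
    also have "\<dots> \<le> (a + b) powr p * (a / (a + b) * (f t / a) powr p + (1 - a / (a + b)) * (g t / b) powr p)"
      using that f0 g0 p by (intro mult_left_mono powr_convex_combination) (auto simp: field_simps)
    also note w
    finally show ?thesis using that f0 g0 by (simp add: powr_divide)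
  qed
  have int: "integrable M (\<lambda>t. (a + b) powr p * (a / (a + b) * (f t powr p / a powr p) + b / (a + b) * (g t powr p / b powr p)))" for a b
    using f g by auto
  show sum: "integrable M (\<lambda>t. (f t + g t) powr p)"
    using pt[of 1 1] by (intro Bochner_Integration.integrable_bound[OF int[of 1 1]] AE_I2) auto
  \<comment> \<open>Numbers strictly above the norms are positive even if a norm is zero; at the end
    they are allowed to approach the norms.\<close>
  have "(LINT t|M. (f t + g t) powr p) powr (1 / p) \<le> a + b" if "a > ?A" "b > ?B" for a b
  proof -
    have ab: "a > 0" "b > 0"
      using that powr_ge_zero[of "LINT t|M. f t powr p" "1 / p"] powr_ge_zero[of "LINT t|M. g t powr p" "1 / p"] by linarith+
    have le: "I \<le> c powr p" if "I powr (1 / p) < c" "0 \<le> I" for I c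
      using powr_mono2[of p "I powr (1 / p)" c] that p by (simp add: powr_powr)
    have "(LINT t|M. (f t + g t) powr p) \<le>
      (LINT t|M. (a + b) powr p * (a / (a + b) * (f t powr p / a powr p) + b / (a + b) * (g t powr p / b powr p)))"
      using ab by (intro integral_mono sum int pt)
    also have "\<dots> = (a + b) powr p * (a / (a + b) * ((LINT t|M. f t powr p) / a powr p) + b / (a + b) * ((LINT t|M. g t powr p) / b powr p))"
      using f g by simp
    also have "\<dots> \<le> (a + b) powr p * (a / (a + b) * 1 + b / (a + b) * 1)"
      using ab le[OF that(1)] le[OF that(2)]
      by (intro mult_left_mono add_mono) (auto simp: divide_le_eq)
    also have "\<dots> = (a + b) powr p" using ab by (simp flip: add_divide_distrib)
    finally have "(LINT t|M. (f t + g t) powr p) powr (1 / p) \<le> ((a + b) powr p) powr (1 / p)"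
      using p by (intro powr_mono2) auto
    then show ?thesis using ab p by (simp add: powr_powr)
  qed
  note bound = this
  show "(LINT t|M. (f t + g t) powr p) powr (1 / p) \<le> ?A + ?B"
  proof (rule field_le_epsilon)
    fix e :: real assume "e > 0"
    then show "(LINT t|M. (f t + g t) powr p) powr (1 / p) \<le> ?A + ?B + e"
      using bound[of "?A + e / 2" "?B + e / 2"] by simp
  qed
qed

section \<open>The Hilbert norm on a fibre\<close>

definition vnorm :: "nat \<Rightarrow> (nat \<Rightarrow> 'k::real_normed_vector) \<Rightarrow> real"
  where "vnorm n v = L2_set (\<lambda>i. norm (v i)) {..<n}"

lemma vnorm_nonneg [simp]: "0 \<le> vnorm n v"
  by (simp add: vnorm_def)

lemma vnorm_power2: "(vnorm n v)\<^sup>2 = (\<Sum>i<n. (norm (v i))\<^sup>2)"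
  by (simp add: vnorm_def L2_set_def sum_nonneg)

lemma vnorm_cong: "(\<And>i. i < n \<Longrightarrow> v i = w i) \<Longrightarrow> vnorm n v = vnorm n w"
  by (simp add: vnorm_def cong: L2_set_cong_simp)

lemma vnorm_eq_0_iff: "vnorm n v = 0 \<longleftrightarrow> (\<forall>i<n. v i = 0)"
  by (auto simp: vnorm_def L2_set_eq_0_iff)

lemma vnorm_triangle: "vnorm n (\<lambda>i. v i + w i) \<le> vnorm n v + vnorm n w"
proof -
  have "vnorm n (\<lambda>i. v i + w i) \<le> L2_set (\<lambda>i. norm (v i) + norm (w i)) {..<n}"
    unfolding vnorm_def by (intro L2_set_mono norm_triangle_ineq) auto
  also have "\<dots> \<le> vnorm n v + vnorm n w"
    unfolding vnorm_def by (rule L2_set_triangle_ineq)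
  finally show ?thesis .
qed

lemma vnorm_mult: "vnorm n (\<lambda>i. c * v i) = norm c * vnorm n v" for c :: "'k::real_normed_div_algebra"
  by (simp add: vnorm_def norm_mult L2_set_right_distrib)

lemma vnorm_scaleR: "vnorm n (\<lambda>i. c *\<^sub>R v i) = \<bar>c\<bar> * vnorm n v"
  by (simp add: vnorm_def L2_set_right_distrib)

lemma norm_le_vnorm: "i < n \<Longrightarrow> norm (v i) \<le> vnorm n v"
  unfolding vnorm_def by (rule member_le_L2_set) auto

lemma vnorm_measurable [measurable (raw)]:
  fixes F :: "nat \<Rightarrow> 'a \<Rightarrow> 'k::real_normed_vector"
  assumes "\<And>i. i < n \<Longrightarrow> F i \<in> borel_measurable M"
  shows "(\<lambda>t. vnorm n (\<lambda>i. F i t)) \<in> borel_measurable M"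
  unfolding vnorm_def L2_set_def using assms by measurable

lemma vnorm_powr_bounds:
  assumes "n > 0" "p \<ge> 0"
  shows "(\<Sum>i<n. norm (v i) powr p) \<le> real n * vnorm n v powr p"
    and "vnorm n v powr p \<le> real n powr p * (\<Sum>i<n. norm (v i) powr p)"
proof -
  have "(\<Sum>i<n. norm (v i) powr p) \<le> (\<Sum>i<n. vnorm n v powr p)"
    using assms by (intro sum_mono powr_mono2 norm_le_vnorm) auto
  then show "(\<Sum>i<n. norm (v i) powr p) \<le> real n * vnorm n v powr p" by simp
  \<comment> \<open>The largest coordinate controls the whole vector: \<open>vnorm n v\<close> is at
    most \<open>n\<close> times its norm.\<close>
  obtain k where k: "k < n" "\<And>i. i < n \<Longrightarrow> norm (v i) \<le> norm (v k)"
    using obtains_MAX[of "{..<n}" "\<lambda>i. norm (v i)"] assms(1)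
    by (metis Max_ge finite_imageI finite_lessThan imageI lessThan_iff lessThan_empty_iff not_gr0)
  have "vnorm n v \<le> (\<Sum>i<n. norm (v i))"
    unfolding vnorm_def by (intro L2_set_le_sum) auto
  also have "\<dots> \<le> (\<Sum>i<n. norm (v k))" using k(2) by (intro sum_mono) auto
  finally have "vnorm n v powr p \<le> (real n * norm (v k)) powr p"
    using assms by (intro powr_mono2) auto
  also have "\<dots> = real n powr p * norm (v k) powr p" by (simp add: powr_mult)
  also have "\<dots> \<le> real n powr p * (\<Sum>i<n. norm (v i) powr p)"
    using k(1) by (intro mult_left_mono member_le_sum) auto
  finally show "vnorm n v powr p \<le> real n powr p * (\<Sum>i<n. norm (v i) powr p)" .
qed

section \<open>The mixed norm and its equivalence with the usual norm\<close>

definition fibre_norm :: "nat \<Rightarrow> 'k::{real_normed_field,second_countable_topology} L0 \<Rightarrow> real \<Rightarrow> real"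
  where "fibre_norm n x t = vnorm n (\<lambda>i. coord n x i t)"

definition mixed_mod :: "real \<Rightarrow> nat \<Rightarrow> 'k::{real_normed_field,second_countable_topology} L0 \<Rightarrow> real"
  where "mixed_mod p n x = (LINT t|\<lambda>\<^sub>0\<^sub>1. fibre_norm n x t powr p)"

definition mixed_norm :: "real \<Rightarrow> nat \<Rightarrow> 'k::{real_normed_field,second_countable_topology} L0 \<Rightarrow> real"
  where "mixed_norm p n x = mixed_mod p n x powr (1 / p)"

lemma fibre_norm_nonneg [simp]: "0 \<le> fibre_norm n x t"
  by (simp add: fibre_norm_def)

lemma fibre_norm_measurable [measurable]: "fibre_norm n x \<in> borel_measurable \<lambda>\<^sub>0\<^sub>1"
  unfolding fibre_norm_def[abs_def] by (intro vnorm_measurable coord_measurable)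

lemma mixed_mod_nonneg [simp]: "0 \<le> mixed_mod p n x"
  by (simp add: mixed_mod_def)

lemma AE_all_less: "(AE t in M. \<forall>i<n. P i t) \<longleftrightarrow> (\<forall>i<n::nat. AE t in M. P i t)"
  using AE_ball_countable[of "{..<n}" "\<lambda>t i. P i t" M] by auto

lemma fibre_norm_cong_AE:
  assumes "\<And>i. i < n \<Longrightarrow> AE t in \<lambda>\<^sub>0\<^sub>1. coord n x i t = F i t"
  shows "AE t in \<lambda>\<^sub>0\<^sub>1. fibre_norm n x t = vnorm n (\<lambda>i. F i t)"
proof -
  have "AE t in \<lambda>\<^sub>0\<^sub>1. \<forall>i<n. coord n x i t = F i t" using assms by (simp add: AE_all_less)
  then show ?thesis by eventually_elim (auto simp: fibre_norm_def intro: vnorm_cong)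
qed

lemma fibre_norm_add: "AE t in \<lambda>\<^sub>0\<^sub>1. fibre_norm n (x + y) t \<le> fibre_norm n x t + fibre_norm n y t"
  using fibre_norm_cong_AE[OF coord_add, of n x y, simplified]
  by eventually_elim (auto simp: fibre_norm_def intro: vnorm_triangle)

lemma fibre_norm_scale: "AE t in \<lambda>\<^sub>0\<^sub>1. fibre_norm n (scale_L0 c x) t = norm c * fibre_norm n x t"
  using fibre_norm_cong_AE[OF coord_scale, of n c x, simplified]
  by eventually_elim (auto simp: fibre_norm_def vnorm_mult)

lemma L0_eq_0_iff_fibre_norm:
  assumes "n > 0"
  shows "x = 0 \<longleftrightarrow> (AE t in \<lambda>\<^sub>0\<^sub>1. fibre_norm n x t = 0)"
proof -
  have "x = 0 \<longleftrightarrow> (\<forall>i<n. AE t in \<lambda>\<^sub>0\<^sub>1. coord n x i t = coord n 0 i t)"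
    by (rule L0_eq_iff_coord[OF assms])
  also have "\<dots> \<longleftrightarrow> (\<forall>i<n. AE t in \<lambda>\<^sub>0\<^sub>1. coord n x i t = 0)"
  proof (intro all_cong1 imp_cong refl)
    fix i assume "i < n"
    from coord_zero[OF this, where ?'a = 'a]
    show "(AE t in \<lambda>\<^sub>0\<^sub>1. coord n x i t = coord n 0 i t) \<longleftrightarrow> (AE t in \<lambda>\<^sub>0\<^sub>1. coord n x i t = 0)"
      by (auto elim: eventually_elim2)
  qed
  also have "\<dots> \<longleftrightarrow> (AE t in \<lambda>\<^sub>0\<^sub>1. fibre_norm n x t = 0)"
    by (simp add: AE_all_less[symmetric] fibre_norm_def vnorm_eq_0_iff)
  finally show ?thesis .
qed

text \<open>On \<open>K^n\<close> the Hilbert norm and the single coordinates dominate each other up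
  to constants. Hence the condition does not depend on \<open>n\<close>, and all mixed norms live on
  the same set \<open>Lp p\<close>.\<close>

lemma Lp_iff_fibre_norm:
  assumes n: "n > 0" and p: "1 \<le> p"
  shows "x \<in> Lp p \<longleftrightarrow> integrable \<lambda>\<^sub>0\<^sub>1 (\<lambda>t. fibre_norm n x t powr p)"
proof -
  have [measurable]: "coord n x i \<in> borel_measurable \<lambda>\<^sub>0\<^sub>1" if "i < n" for i
    using that by (rule coord_measurable)
  let ?S = "\<lambda>t. \<Sum>i<n. norm (coord n x i t) powr p"
  have [measurable]: "?S \<in> borel_measurable \<lambda>\<^sub>0\<^sub>1" by measurable
  have "x \<in> Lp p \<longleftrightarrow> (\<forall>i<n. integrable \<lambda>\<^sub>0\<^sub>1 (\<lambda>t. norm (coord n x i t) powr p))"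
    by (simp add: Lp_iff_rep L0_integral_coord(1)[OF n])
  also have "\<dots> \<longleftrightarrow> integrable \<lambda>\<^sub>0\<^sub>1 (\<lambda>t. fibre_norm n x t powr p)"
  proof safe
    assume *: "\<forall>i<n. integrable \<lambda>\<^sub>0\<^sub>1 (\<lambda>t. norm (coord n x i t) powr p)"
    show "integrable \<lambda>\<^sub>0\<^sub>1 (\<lambda>t. fibre_norm n x t powr p)"
    proof (rule Bochner_Integration.integrable_bound)
      show "integrable \<lambda>\<^sub>0\<^sub>1 (\<lambda>t. real n powr p * ?S t)" using * by auto
    qed (use vnorm_powr_bounds(2)[OF n, of p] p in \<open>auto simp: fibre_norm_def sum_nonneg\<close>)
  next
    fix i assume *: "integrable \<lambda>\<^sub>0\<^sub>1 (\<lambda>t. fibre_norm n x t powr p)" and i: "i < n"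
    show "integrable \<lambda>\<^sub>0\<^sub>1 (\<lambda>t. norm (coord n x i t) powr p)"
      using p i by (intro Bochner_Integration.integrable_bound[OF *])
        (auto simp: fibre_norm_def intro!: powr_mono2 norm_le_vnorm)
  qed
  finally show ?thesis .
qed

lemma Lp_norm_mixed_norm_bounds:
  assumes n: "n > 0" and p: "1 \<le> p" and x: "x \<in> Lp p"
  shows "Lp_norm p x \<le> mixed_norm p n x"
    and "mixed_norm p n x \<le> (real n powr p * real n) powr (1 / p) * Lp_norm p x"
proof -
  let ?L = "LINT t|\<lambda>\<^sub>0\<^sub>1. norm (rep_L0 x t) powr p"
  let ?S = "\<lambda>t. \<Sum>i<n. norm (coord n x i t) powr p"
  have ci: "integrable \<lambda>\<^sub>0\<^sub>1 (\<lambda>t. norm (coord n x i t) powr p)" if "i < n" for i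
    using x that unfolding Lp_iff_rep L0_integral_coord(1)[OF n] by blast
  then have S: "integrable \<lambda>\<^sub>0\<^sub>1 ?S" by auto
  have L: "(LINT t|\<lambda>\<^sub>0\<^sub>1. ?S t) = real n * ?L"
    using x n ci unfolding Lp_iff_rep by (subst L0_integral_coord(2)[OF n]) auto
  have F: "integrable \<lambda>\<^sub>0\<^sub>1 (\<lambda>t. fibre_norm n x t powr p)"
    using x by (simp add: Lp_iff_fibre_norm[OF n p])
  have "(LINT t|\<lambda>\<^sub>0\<^sub>1. ?S t) \<le> (LINT t|\<lambda>\<^sub>0\<^sub>1. real n * fibre_norm n x t powr p)"
    using S F p vnorm_powr_bounds(1)[OF n, of p] by (intro integral_mono) (auto simp: fibre_norm_def)
  \<comment> \<open>The factor \<open>n\<close> of the pointwise bound cancels the factor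
    \<open>1/n\<close> coming from the length of the pieces.\<close>
  then have "?L \<le> mixed_mod p n x" using n by (simp add: L mixed_mod_def)
  then show "Lp_norm p x \<le> mixed_norm p n x"
    using p by (simp add: Lp_norm_rep mixed_norm_def powr_mono2)
  have "mixed_mod p n x \<le> (LINT t|\<lambda>\<^sub>0\<^sub>1. real n powr p * ?S t)"
    unfolding mixed_mod_def
    using S F p vnorm_powr_bounds(2)[OF n, of p] by (intro integral_mono) (auto simp: fibre_norm_def)
  also have "\<dots> = real n powr p * real n * ?L" by (simp add: L)
  finally have "mixed_norm p n x \<le> (real n powr p * real n * ?L) powr (1 / p)"
    unfolding mixed_norm_def using p by (intro powr_mono2) auto
  also have "\<dots> = (real n powr p * real n) powr (1 / p) * Lp_norm p x"
    by (simp add: Lp_norm_rep powr_mult)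
  finally show "mixed_norm p n x \<le> (real n powr p * real n) powr (1 / p) * Lp_norm p x" .
qed

lemma equivalent_mixed_norm:
  assumes n: "n > 0" and p: "1 \<le> p"
  shows "equivalent_norms_on (Lp p) (mixed_norm p n) (Lp_norm p)"
  unfolding equivalent_norms_on_def
  using Lp_norm_mixed_norm_bounds[OF n p] n
  by (intro exI[of _ 1] exI[of _ "(real n powr p * real n) powr (1 / p)"] conjI) auto

lemma Lp_add_mixed_norm:
  assumes n: "n > 0" and p: "1 \<le> p" and x: "x \<in> Lp p" and y: "y \<in> Lp p"
  shows "x + y \<in> Lp p" and "mixed_norm p n (x + y) \<le> mixed_norm p n x + mixed_norm p n y"
proof -
  have xy: "integrable \<lambda>\<^sub>0\<^sub>1 (\<lambda>t. fibre_norm n x t powr p)" "integrable \<lambda>\<^sub>0\<^sub>1 (\<lambda>t. fibre_norm n y t powr p)"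
    using x y by (simp_all add: Lp_iff_fibre_norm[OF n p])
  note M = Minkowski_powr[OF p fibre_norm_nonneg fibre_norm_nonneg fibre_norm_measurable fibre_norm_measurable xy]
  have le: "AE t in \<lambda>\<^sub>0\<^sub>1. fibre_norm n (x + y) t powr p \<le> (fibre_norm n x t + fibre_norm n y t) powr p"
    using fibre_norm_add[of n x y] by eventually_elim (use p in \<open>auto intro: powr_mono2\<close>)
  have i: "integrable \<lambda>\<^sub>0\<^sub>1 (\<lambda>t. fibre_norm n (x + y) t powr p)"
    using le by (intro Bochner_Integration.integrable_bound[OF M(1)]) (auto elim: eventually_mono)
  then show "x + y \<in> Lp p" by (simp add: Lp_iff_fibre_norm[OF n p])
  have "mixed_mod p n (x + y) \<le> (LINT t|\<lambda>\<^sub>0\<^sub>1. (fibre_norm n x t + fibre_norm n y t) powr p)"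
    unfolding mixed_mod_def using i M(1) le by (intro integral_mono_AE)
  then have "mixed_norm p n (x + y) \<le> (LINT t|\<lambda>\<^sub>0\<^sub>1. (fibre_norm n x t + fibre_norm n y t) powr p) powr (1 / p)"
    unfolding mixed_norm_def using p by (intro powr_mono2) auto
  also have "\<dots> \<le> mixed_norm p n x + mixed_norm p n y"
    using M(2) by (simp add: mixed_norm_def mixed_mod_def)
  finally show "mixed_norm p n (x + y) \<le> mixed_norm p n x + mixed_norm p n y" .
qed

lemma mixed_mod_scale:
  "mixed_mod p n (scale_L0 c x) = norm c powr p * mixed_mod p n x"
proof -
  have "mixed_mod p n (scale_L0 c x) = (LINT t|\<lambda>\<^sub>0\<^sub>1. norm c powr p * fibre_norm n x t powr p)"
    unfolding mixed_mod_def
  proof (rule integral_cong_AE)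
    show "AE t in \<lambda>\<^sub>0\<^sub>1. fibre_norm n (scale_L0 c x) t powr p = norm c powr p * fibre_norm n x t powr p"
      using fibre_norm_scale[of n c x] by eventually_elim (simp add: powr_mult)
  qed measurable
  then show ?thesis by (simp add: mixed_mod_def)
qed

lemma mixed_norm_scale:
  assumes "1 \<le> p"
  shows "mixed_norm p n (scale_L0 c x) = norm c * mixed_norm p n x"
  using assms by (simp add: mixed_norm_def mixed_mod_scale powr_mult powr_powr)

lemma Lp_scale:
  assumes p: "1 \<le> p" and x: "x \<in> Lp p"
  shows "scale_L0 c x \<in> Lp p"
proof -
  have "integrable \<lambda>\<^sub>0\<^sub>1 (\<lambda>t. norm c powr p * fibre_norm 1 x t powr p)"
    \<comment> \<open>Membership does not depend on the number of pieces, so a single piece is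
      enough.\<close>
    using x Lp_iff_fibre_norm[OF _ p, of 1 x] by simp
  also have "?this \<longleftrightarrow> integrable \<lambda>\<^sub>0\<^sub>1 (\<lambda>t. fibre_norm 1 (scale_L0 c x) t powr p)"
  proof (rule integrable_cong_AE)
    show "AE t in \<lambda>\<^sub>0\<^sub>1. norm c powr p * fibre_norm 1 x t powr p = fibre_norm 1 (scale_L0 c x) t powr p"
      using fibre_norm_scale[of 1 c x] by eventually_elim (simp add: powr_mult)
  qed measurable
  finally show ?thesis using Lp_iff_fibre_norm[OF zero_less_one p] by blast
qed

lemma scale_L0_minus_one: "scale_L0 (- 1) x = - x"
proof -
  interpret vector_space "scale_L0 :: 'a \<Rightarrow> 'a L0 \<Rightarrow> _" by (rule vector_space_scale_L0)
  show ?thesis by simp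
qed

lemma Lp_diff:
  assumes p: "1 \<le> p" and x: "x \<in> Lp p" and y: "y \<in> Lp p"
  shows "x - y \<in> Lp p"
  using Lp_add_mixed_norm(1)[OF zero_less_one p x Lp_scale[OF p y, of "- 1"]]
  by (simp add: scale_L0_minus_one)

lemma mixed_norm_eq_0_iff:
  assumes n: "n > 0" and p: "1 \<le> p" and x: "x \<in> Lp p"
  shows "mixed_norm p n x = 0 \<longleftrightarrow> x = 0"
proof -
  have "integrable \<lambda>\<^sub>0\<^sub>1 (\<lambda>t. fibre_norm n x t powr p)"
    using x by (simp add: Lp_iff_fibre_norm[OF n p])
  then have "mixed_norm p n x = 0 \<longleftrightarrow> (AE t in \<lambda>\<^sub>0\<^sub>1. fibre_norm n x t powr p = 0)"
    by (simp add: mixed_norm_def mixed_mod_def integral_nonneg_eq_0_iff_AE)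
  then show ?thesis by (simp add: L0_eq_0_iff_fibre_norm[OF n])
qed

lemma norm_on_mixed_norm:
  assumes n: "n > 0" and p: "1 \<le> p"
  shows "norm_on (Lp p) (mixed_norm p n)"
  unfolding norm_on_def
  using mixed_norm_eq_0_iff[OF n p] Lp_add_mixed_norm[OF n p] mixed_norm_scale[OF p]
  by (auto simp: mixed_norm_def)

section \<open>Approximation by continuous densities\<close>

text \<open>Strict monotonicity follows from the mean value theorem and \<open>q > 0\<close>,
  surjectivity from the intermediate value theorem.\<close>

lemma indefinite_integral_diffeo:
  fixes q :: "real \<Rightarrow> real"
  assumes cont: "continuous_on {0..1} q" and pos: "\<And>t. t \<in> {0..1} \<Longrightarrow> q t > 0"
    and one: "integral {0..1} q = 1"
  shows "interval_diffeo 0 1 0 1 (\<lambda>t. integral {0..t} q) q"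
proof
  let ?\<phi> = "\<lambda>t. integral {0..t} q"
  show der: "(?\<phi> has_real_derivative q x) (at x within {0..1})" if "x \<in> {0..1}" for x
    by (rule integral_has_real_derivative[OF cont that])
  have less: "?\<phi> x < ?\<phi> y" if "x < y" "x \<in> {0..1}" "y \<in> {0..1}" for x y
  proof -
    have "(?\<phi> has_derivative (\<lambda>h. h * q z)) (at z within {x..y})" if "x \<le> z" "z \<le> y" for z
      using der[of z] \<open>x \<in> {0..1}\<close> \<open>y \<in> {0..1}\<close> that unfolding has_field_derivative_def
      by (subst mult.commute) (auto intro: has_derivative_subset)
    from mvt_simple[OF \<open>x < y\<close> this]
    obtain z where z: "z \<in> {x<..<y}" "?\<phi> y - ?\<phi> x = (y - x) * q z" by auto
    moreover have "q z > 0" using z that by (intro pos) auto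
    ultimately show ?thesis using \<open>x < y\<close>
      by (metis diff_gt_0_iff_gt mult_pos_pos)
  qed
  have ends: "?\<phi> 0 = 0" "?\<phi> 1 = 1" using one by auto
  have le: "?\<phi> x \<le> ?\<phi> y" if "x \<le> y" "x \<in> {0..1}" "y \<in> {0..1}" for x y
    using less[of x y] that by (cases "x = y") auto
  have contp: "continuous_on {0..1} ?\<phi>"
    by (rule indefinite_integral_continuous_1) (rule integrable_continuous_real[OF cont])
  show "bij_betw ?\<phi> {0..1} {0..1}"
    unfolding bij_betw_def
  proof (intro conjI inj_onI equalityI subsetI)
    fix x y assume "x \<in> {0..1}" "y \<in> {0..1}" "?\<phi> x = ?\<phi> y"
    then show "x = y" using less[of x y] less[of y x] by linarith
  next
    fix z assume "z \<in> ?\<phi> ` {0..1}"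
    then obtain x where x: "x \<in> {0..1}" "z = ?\<phi> x" by auto
    then show "z \<in> {0..1}" using le[of 0 x] le[of x 1] ends by auto
  next
    fix z :: real assume "z \<in> {0..1}"
    then show "z \<in> ?\<phi> ` {0..1}" using IVT'[of ?\<phi> 0 z 1] contp ends by auto
  qed
qed (use assms in auto)

definition Lp_seminorm :: "real \<Rightarrow> (real \<Rightarrow> real) \<Rightarrow> real"
  where "Lp_seminorm p f = (LINT t|\<lambda>\<^sub>0\<^sub>1. \<bar>f t\<bar> powr p) powr (1 / p)"

lemma Lp_seminorm_add:
  assumes p: "1 \<le> p"
    and m [measurable]: "f \<in> borel_measurable \<lambda>\<^sub>0\<^sub>1" "g \<in> borel_measurable \<lambda>\<^sub>0\<^sub>1"
    and i: "integrable \<lambda>\<^sub>0\<^sub>1 (\<lambda>t. \<bar>f t\<bar> powr p)" "integrable \<lambda>\<^sub>0\<^sub>1 (\<lambda>t. \<bar>g t\<bar> powr p)"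
  shows "integrable \<lambda>\<^sub>0\<^sub>1 (\<lambda>t. \<bar>f t + g t\<bar> powr p)"
    and "Lp_seminorm p (\<lambda>t. f t + g t) \<le> Lp_seminorm p f + Lp_seminorm p g"
proof -
  have M: "integrable \<lambda>\<^sub>0\<^sub>1 (\<lambda>t. (\<bar>f t\<bar> + \<bar>g t\<bar>) powr p)"
    "(LINT t|\<lambda>\<^sub>0\<^sub>1. (\<bar>f t\<bar> + \<bar>g t\<bar>) powr p) powr (1 / p) \<le> Lp_seminorm p f + Lp_seminorm p g"
    unfolding Lp_seminorm_def by (rule Minkowski_powr[OF p]; use i in simp)+
  have le: "\<bar>f t + g t\<bar> powr p \<le> (\<bar>f t\<bar> + \<bar>g t\<bar>) powr p" for t
    using p by (intro powr_mono2) auto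
  show I: "integrable \<lambda>\<^sub>0\<^sub>1 (\<lambda>t. \<bar>f t + g t\<bar> powr p)"
    using le by (intro Bochner_Integration.integrable_bound[OF M(1)]) auto
  have "(LINT t|\<lambda>\<^sub>0\<^sub>1. \<bar>f t + g t\<bar> powr p) powr (1 / p) \<le> (LINT t|\<lambda>\<^sub>0\<^sub>1. (\<bar>f t\<bar> + \<bar>g t\<bar>) powr p) powr (1 / p)"
    using I M(1) le p by (intro powr_mono2 integral_mono) auto
  then show "Lp_seminorm p (\<lambda>t. f t + g t) \<le> Lp_seminorm p f + Lp_seminorm p g"
    using M(2) unfolding Lp_seminorm_def by linarith
qed

lemma Lp_seminorm_minus: "Lp_seminorm p (\<lambda>t. - f t) = Lp_seminorm p f"
  by (simp add: Lp_seminorm_def)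

lemma Lp_seminorm_cmult: "1 \<le> p \<Longrightarrow> Lp_seminorm p (\<lambda>t. c * f t) = \<bar>c\<bar> * Lp_seminorm p f"
  by (simp add: Lp_seminorm_def abs_mult powr_mult powr_powr)

lemma finite_measure_unit_interval: "finite_measure \<lambda>\<^sub>0\<^sub>1"
  by (intro finite_measure_lebesgue_on) auto

lemma Lp_seminorm_const: "1 \<le> p \<Longrightarrow> Lp_seminorm p (\<lambda>_. c) = \<bar>c\<bar>"
  by (simp add: Lp_seminorm_def powr_powr measure_restrict_space)

text \<open>Dominated convergence for the \<open>p\<close>-th powers with majorant
  \<open>w powr p\<close>, followed by continuity of the power \<open>1 / p\<close> at zero.\<close>

lemma Lp_seminorm_tendsto_0:
  assumes p: "1 \<le> p" and [measurable]: "\<And>k. h k \<in> borel_measurable \<lambda>\<^sub>0\<^sub>1" "w \<in> borel_measurable \<lambda>\<^sub>0\<^sub>1"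
    and w: "integrable \<lambda>\<^sub>0\<^sub>1 (\<lambda>t. w t powr p)"
    and le: "\<And>k t. \<bar>h k t\<bar> \<le> w t"
    and lim: "AE t in \<lambda>\<^sub>0\<^sub>1. (\<lambda>k. h k t) \<longlonglongrightarrow> 0"
  shows "(\<lambda>k. Lp_seminorm p (h k)) \<longlonglongrightarrow> 0"
proof -
  have "(\<lambda>k. LINT t|\<lambda>\<^sub>0\<^sub>1. \<bar>h k t\<bar> powr p) \<longlonglongrightarrow> (LINT t|\<lambda>\<^sub>0\<^sub>1. 0)"
  proof (rule integral_dominated_convergence[OF _ _ w])
    show "AE t in \<lambda>\<^sub>0\<^sub>1. (\<lambda>k. \<bar>h k t\<bar> powr p) \<longlonglongrightarrow> 0"
      using lim
    proof eventually_elim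
      case (elim t)
      then have "(\<lambda>k. \<bar>h k t\<bar>) \<longlonglongrightarrow> 0" by (rule tendsto_rabs_zero)
      from tendsto_zero_powrI[OF this tendsto_const[of p]] show ?case using p by auto
    qed
    show "AE t in \<lambda>\<^sub>0\<^sub>1. norm (\<bar>h k t\<bar> powr p) \<le> w t powr p" for k
      using le p by (auto intro!: AE_I2 powr_mono2)
  qed measurable
  then have "(\<lambda>k. LINT t|\<lambda>\<^sub>0\<^sub>1. \<bar>h k t\<bar> powr p) \<longlonglongrightarrow> 0" by simp
  from tendsto_zero_powrI[OF this tendsto_const[of "1 / p"]] show ?thesis
    using p unfolding Lp_seminorm_def by auto
qed

text \<open>The function is truncated, replaced by a continuous function with the same bounds,
  shifted upwards to become positive, and finally divided by its norm.\<close>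

lemma continuous_positive_approximation:
  assumes p: "1 \<le> p" and gm [measurable]: "g \<in> borel_measurable \<lambda>\<^sub>0\<^sub>1" and g0: "\<And>t. 0 \<le> g t"
    and gi: "integrable \<lambda>\<^sub>0\<^sub>1 (\<lambda>t. g t powr p)" and g1: "(LINT t|\<lambda>\<^sub>0\<^sub>1. g t powr p) = 1"
    and e: "\<epsilon> > 0"
  obtains h where "continuous_on {0..1} h" "\<forall>t\<in>{0..1}. h t > 0"
    "(LINT t|\<lambda>\<^sub>0\<^sub>1. h t powr p) = 1" "Lp_seminorm p (\<lambda>t. g t - h t) \<le> \<epsilon>"
proof -
  interpret finite_measure "\<lambda>\<^sub>0\<^sub>1" by (rule finite_measure_unit_interval)
  \<comment> \<open>Truncation, continuous approximation and the shift cost at most \<delta> each,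
    the normalisation at most three times \<delta>. The bound \<open>8 * \<delta> \<le> 1\<close>
    keeps the norm \<beta> positive.\<close>
  define \<delta> where "\<delta> = min \<epsilon> 1 / 8"
  have d: "\<delta> > 0" "8 * \<delta> \<le> \<epsilon>" "8 * \<delta> \<le> 1" using e by (auto simp: \<delta>_def)
  have "(\<lambda>k. Lp_seminorm p (\<lambda>t. g t - min (g t) (real k))) \<longlonglongrightarrow> 0"
  proof (rule Lp_seminorm_tendsto_0[OF p _ gm gi])
    show "AE t in \<lambda>\<^sub>0\<^sub>1. (\<lambda>k. g t - min (g t) (real k)) \<longlonglongrightarrow> 0"
    proof (rule AE_I2)
      fix t
      have "\<forall>\<^sub>F k in sequentially. g t - min (g t) (real k) = 0"
        using eventually_ge_at_top[of "nat \<lceil>g t\<rceil>"] by eventually_elim (auto simp: min_def)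
      then show "(\<lambda>k. g t - min (g t) (real k)) \<longlonglongrightarrow> 0" by (rule tendsto_eventually)
    qed
  qed (use g0 in \<open>auto simp: min_def\<close>)
  then obtain K where K: "Lp_seminorm p (\<lambda>t. g t - min (g t) (real K)) < \<delta>"
    using d by (metis (no_types, lifting) order_tendstoD(2) eventually_sequentially order_refl)
  \<comment> \<open>This form of measurability provides continuous functions that converge to
    \<open>g\<close> off a negligible set; clipping them to the range from 0 to \<open>K\<close>
    yields a constant majorant.\<close>
  have "g measurable_on {0..1}" using gm by (simp add: measurable_on_iff_borel_measurable)
  then obtain N c where N: "negligible N" and c: "\<And>k::nat. continuous_on UNIV (c k)"
    and lim: "\<And>t. t \<notin> N \<Longrightarrow> (\<lambda>k. c k t) \<longlonglongrightarrow> (if t \<in> {0..1} then g t else 0)"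
    unfolding measurable_on_def by blast
  let ?c = "\<lambda>k t. max 0 (min (c k t) (real K))"
  have cc: "continuous_on {0..1} (?c k)" for k
    by (intro continuous_intros continuous_on_subset[OF c]) auto
  then have [measurable]: "?c k \<in> borel_measurable \<lambda>\<^sub>0\<^sub>1" for k
    by (intro continuous_imp_measurable_on_sets_lebesgue) auto
  have bd: "\<bar>min (g t) (real K) - ?c k t\<bar> \<le> real K" for k t
    using g0[of t] by linarith
  have "(\<lambda>k. Lp_seminorm p (\<lambda>t. min (g t) (real K) - ?c k t)) \<longlonglongrightarrow> 0"
  proof (rule Lp_seminorm_tendsto_0[OF p, where w = "\<lambda>_. real K"])
    have "AE t in \<lambda>\<^sub>0\<^sub>1. t \<notin> N"
    proof -
      have "{t \<in> {0..1}. \<not> t \<notin> N} \<in> null_sets lebesgue"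
        using N negligible_subset[of N "{t \<in> {0..1}. \<not> t \<notin> N}"] by (auto simp: negligible_iff_null_sets)
      then show ?thesis by (subst AE_lebesgue_on_iff_null) auto
    qed
    then show "AE t in \<lambda>\<^sub>0\<^sub>1. (\<lambda>k. min (g t) (real K) - ?c k t) \<longlonglongrightarrow> 0"
      using AE_space
    proof eventually_elim
      case (elim t)
      then have "(\<lambda>k. c k t) \<longlonglongrightarrow> g t" using lim[of t] by simp
      then have "(\<lambda>k. min (g t) (real K) - ?c k t) \<longlonglongrightarrow> min (g t) (real K) - max 0 (min (g t) (real K))"
        by (intro tendsto_intros)
      then show ?case using g0[of t] by (simp add: max_def)
    qed
  qed (use bd in auto)
  then obtain k where k: "Lp_seminorm p (\<lambda>t. min (g t) (real K) - ?c k t) < \<delta>"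
    using d by (metis (no_types, lifting) order_tendstoD(2) eventually_sequentially order_refl)
  define b where "b t = ?c k t + \<delta>" for t
  have bc: "continuous_on {0..1} b" unfolding b_def by (intro continuous_intros cc)
  have b0: "b t > 0" for t using d by (simp add: b_def)
  have [measurable]: "b \<in> borel_measurable \<lambda>\<^sub>0\<^sub>1"
    using bc by (intro continuous_imp_measurable_on_sets_lebesgue) auto
  have bi: "integrable \<lambda>\<^sub>0\<^sub>1 (\<lambda>t. \<bar>b t\<bar> powr p)"
    using b0 p d by (intro integrable_const_bound[where B = "(real K + \<delta>) powr p"])
      (auto intro!: powr_mono2 AE_I2 simp: b_def)
  have gi': "integrable \<lambda>\<^sub>0\<^sub>1 (\<lambda>t. \<bar>g t\<bar> powr p)" using gi g0 by simp
  have i1: "integrable \<lambda>\<^sub>0\<^sub>1 (\<lambda>t. \<bar>g t - min (g t) (real K)\<bar> powr p)"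
    using g0 p by (intro Bochner_Integration.integrable_bound[OF gi]) (auto intro!: powr_mono2 AE_I2 simp: min_def)
  have i2: "integrable \<lambda>\<^sub>0\<^sub>1 (\<lambda>t. \<bar>min (g t) (real K) - ?c k t\<bar> powr p)"
    using bd p by (intro integrable_const_bound[where B = "real K powr p"]) (auto intro!: powr_mono2 AE_I2)
  have i3: "integrable \<lambda>\<^sub>0\<^sub>1 (\<lambda>t. \<bar>- \<delta>\<bar> powr p)" by simp
  note s1 = Lp_seminorm_add[OF p _ _ i1 i2]
  have i4: "integrable \<lambda>\<^sub>0\<^sub>1 (\<lambda>t. \<bar>(g t - min (g t) (real K)) + (min (g t) (real K) - ?c k t)\<bar> powr p)"
    by (rule s1(1)) measurable
  have "Lp_seminorm p (\<lambda>t. ((g t - min (g t) (real K)) + (min (g t) (real K) - ?c k t)) + - \<delta>)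
      \<le> Lp_seminorm p (\<lambda>t. (g t - min (g t) (real K)) + (min (g t) (real K) - ?c k t)) + Lp_seminorm p (\<lambda>t. - \<delta>)"
    by (rule Lp_seminorm_add(2)[OF p _ _ i4 i3]) measurable
  also have "\<dots> \<le> Lp_seminorm p (\<lambda>t. g t - min (g t) (real K)) + Lp_seminorm p (\<lambda>t. min (g t) (real K) - ?c k t) + \<delta>"
    using Lp_seminorm_const[OF p, of "- \<delta>"] d s1(2) by simp
  also have "\<dots> \<le> 3 * \<delta>" using K k by simp
  also have "(\<lambda>t. ((g t - min (g t) (real K)) + (min (g t) (real K) - ?c k t)) + - \<delta>) = (\<lambda>t. g t - b t)"
    by (auto simp: b_def)
  finally have gb: "Lp_seminorm p (\<lambda>t. g t - b t) \<le> 3 * \<delta>" .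
  have gbi: "integrable \<lambda>\<^sub>0\<^sub>1 (\<lambda>t. \<bar>g t - b t\<bar> powr p)"
    using Lp_seminorm_add(1)[OF p, of g "\<lambda>t. - b t"] gi' bi by simp
  have gn: "Lp_seminorm p g = 1" using g0 g1 by (simp add: Lp_seminorm_def)
  define \<beta> where "\<beta> = Lp_seminorm p b"
  have "\<beta> \<le> 1 + 3 * \<delta>"
    using Lp_seminorm_add(2)[OF p, of "\<lambda>t. - (g t - b t)" g] gbi gi' gb gn
    unfolding Lp_seminorm_minus by (simp add: \<beta>_def abs_minus_commute)
  moreover have "1 \<le> \<beta> + 3 * \<delta>"
    using Lp_seminorm_add(2)[OF p, of "\<lambda>t. g t - b t" b] gbi bi gb gn
    by (simp add: \<beta>_def)
  ultimately have \<beta>: "\<bar>\<beta> - 1\<bar> \<le> 3 * \<delta>" "\<beta> > 0" using d by auto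
  \<comment> \<open>Dividing by the norm moves \<open>b\<close> by
    \<open>\<bar>1 - 1 / \<beta>\<bar> * \<beta>\<close>, which equals
    \<open>\<bar>\<beta> - 1\<bar>\<close> and was bounded by the triangle inequality in both
    directions.\<close>
  define h where "h t = (1 / \<beta>) * b t" for t
  have hi: "integrable \<lambda>\<^sub>0\<^sub>1 (\<lambda>t. \<bar>b t - h t\<bar> powr p)"
  proof -
    have "b t - h t = (1 - 1 / \<beta>) * b t" for t by (simp add: h_def algebra_simps)
    then show ?thesis using bi by (simp add: abs_mult powr_mult)
  qed
  have "Lp_seminorm p (\<lambda>t. b t - h t) = \<bar>1 - 1 / \<beta>\<bar> * \<beta>"
  proof -
    have "b t - h t = (1 - 1 / \<beta>) * b t" for t by (simp add: h_def algebra_simps)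
    then show ?thesis using Lp_seminorm_cmult[OF p, of "1 - 1 / \<beta>" b] by (simp add: \<beta>_def)
  qed
  also have "\<dots> = \<bar>\<beta> - 1\<bar>" using \<beta> by (simp add: abs_if field_simps)
  finally have bh: "Lp_seminorm p (\<lambda>t. b t - h t) \<le> 3 * \<delta>" using \<beta> by simp
  have [measurable]: "h \<in> borel_measurable \<lambda>\<^sub>0\<^sub>1" unfolding h_def by measurable
  have "Lp_seminorm p (\<lambda>t. g t - h t) \<le> Lp_seminorm p (\<lambda>t. g t - b t) + Lp_seminorm p (\<lambda>t. b t - h t)"
    using Lp_seminorm_add(2)[OF p _ _ gbi hi] by simp
  then have "Lp_seminorm p (\<lambda>t. g t - h t) \<le> \<epsilon>" using gb bh d by linarith
  moreover have "continuous_on {0..1} h" unfolding h_def by (intro continuous_intros bc)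
  moreover have hp: "h t > 0" for t using b0 \<beta> by (simp add: h_def)
  moreover have "(LINT t|\<lambda>\<^sub>0\<^sub>1. h t powr p) = 1"
  proof -
    have "Lp_seminorm p h = 1"
      using Lp_seminorm_cmult[OF p, of "1 / \<beta>" b] \<beta> unfolding h_def by (simp add: \<beta>_def[symmetric])
    then have "(LINT t|\<lambda>\<^sub>0\<^sub>1. h t powr p) powr (1 / p) = 1"
      using hp by (simp add: Lp_seminorm_def less_imp_le)
    then have "((LINT t|\<lambda>\<^sub>0\<^sub>1. h t powr p) powr (1 / p)) powr p = 1" by simp
    then show ?thesis using p by (simp add: powr_powr)
  qed
  ultimately show ?thesis using that by blast
qed

section \<open>Almost transitivity\<close>

lemma linear_on_diff:
  assumes "linear_on V T" "x \<in> V" "y \<in> V" "\<And>c x. x \<in> V \<Longrightarrow> scale_L0 c x \<in> V"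
  shows "T (x - y) = T x - T y"
proof -
  have "T (x + scale_L0 (- 1) y) = T x + scale_L0 (- 1) (T y)"
    using assms unfolding linear_on_def by metis
  then show ?thesis by (simp add: scale_L0_minus_one)
qed

lemma linear_on_inv_into:
  assumes T: "linear_on V T" "bij_betw T V V"
    and add: "\<And>x y. x \<in> V \<Longrightarrow> y \<in> V \<Longrightarrow> x + y \<in> V" and scale: "\<And>c x. x \<in> V \<Longrightarrow> scale_L0 c x \<in> V"
  shows "linear_on V (inv_into V T)"
proof -
  let ?S = "inv_into V T"
  have S: "?S y \<in> V" "T (?S y) = y" if "y \<in> V" for y
    using that T(2) by (auto simp: bij_betw_def inv_into_into f_inv_into_f)
  have ST: "?S (T x) = x" if "x \<in> V" for x using that T(2) by (simp add: bij_betw_def)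
  show ?thesis
    unfolding linear_on_def
  proof safe
    fix x y assume "x \<in> V" "y \<in> V"
    then have "x + y = T (?S x + ?S y)" using T(1) S by (simp add: linear_on_def)
    then show "?S (x + y) = ?S x + ?S y" using ST add S \<open>x \<in> V\<close> \<open>y \<in> V\<close> by simp
  next
    fix c x assume "x \<in> V"
    then have "scale_L0 c x = T (scale_L0 c (?S x))" using T(1) S by (simp add: linear_on_def)
    then show "?S (scale_L0 c x) = scale_L0 c (?S x)" using ST scale S \<open>x \<in> V\<close> by simp
  qed
qed

lemma surj_linear_isometry_on_comp:
  assumes "surj_linear_isometry_on V N S" "surj_linear_isometry_on V N T"
  shows "surj_linear_isometry_on V N (\<lambda>x. S (T x))"
proof -
  have "T x \<in> V" if "x \<in> V" for x using assms that by (auto simp: surj_linear_isometry_on_def)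
  moreover have "(\<lambda>x. S (T x)) ` V = V"
    using assms unfolding surj_linear_isometry_on_def by (metis image_image)
  ultimately show ?thesis
    using assms unfolding surj_linear_isometry_on_def linear_on_def by simp
qed

lemma surj_linear_isometry_on_inverse:
  assumes n: "n > 0" and p: "1 \<le> p" and T: "surj_linear_isometry_on (Lp p) (mixed_norm p n) T"
  obtains S where "surj_linear_isometry_on (Lp p) (mixed_norm p n) S"
    "\<And>x. x \<in> Lp p \<Longrightarrow> S (T x) = x" "\<And>x. x \<in> Lp p \<Longrightarrow> T (S x) = x"
proof
  let ?V = "Lp p :: 'a L0 set"
  let ?S = "inv_into ?V T"
  have lin: "linear_on ?V T" and im: "T ` ?V = ?V" and iso: "\<And>x. x \<in> ?V \<Longrightarrow> mixed_norm p n (T x) = mixed_norm p n x"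
    using T by (auto simp: surj_linear_isometry_on_def)
  \<comment> \<open>The definition of an isometry asks for surjectivity only. Points with the same
    image have a difference that is mapped to 0, so this difference has norm zero.\<close>
  have inj: "inj_on T ?V"
  proof (rule inj_onI)
    fix x y assume xy: "x \<in> ?V" "y \<in> ?V" "T x = T y"
    have "T (x - y) = 0" using linear_on_diff[OF lin xy(1,2) Lp_scale[OF p]] xy by simp
    moreover have "mixed_norm p n (T (x - y)) = mixed_norm p n (x - y)" using xy by (intro iso Lp_diff[OF p])
    moreover have "(0::'a L0) \<in> ?V" using Lp_diff[OF p xy(1) xy(1)] by simp
    ultimately have "mixed_norm p n (x - y) = 0" using mixed_norm_eq_0_iff[OF n p, of 0] by metis
    then show "x = y" using mixed_norm_eq_0_iff[OF n p Lp_diff[OF p xy(1,2)]] by simp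
  qed
  then have bij: "bij_betw T ?V ?V" using im by (simp add: bij_betw_def)
  show 1: "?S (T x) = x" if "x \<in> ?V" for x using inj that by simp
  show 2: "T (?S x) = x" if "x \<in> ?V" for x using im that by (simp add: f_inv_into_f)
  have into: "?S x \<in> ?V" if "x \<in> ?V" for x using im that by (simp add: inv_into_into)
  have "linear_on ?V ?S"
    using linear_on_inv_into[OF lin bij] Lp_add_mixed_norm(1)[OF n p] Lp_scale[OF p] by blast
  moreover have "?S ` ?V = ?V" using bij_betw_inv_into[OF bij] by (simp add: bij_betw_def)
  moreover have "mixed_norm p n (?S x) = mixed_norm p n x" if "x \<in> ?V" for x
    using iso[OF into[OF that]] 2[OF that] by simp
  ultimately show "surj_linear_isometry_on ?V (mixed_norm p n) ?S"
    by (simp add: surj_linear_isometry_on_def)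
qed

text \<open>Transfers a map \<open>A\<close> on tuples of functions to the space of classes;
  \<open>cong\<close> makes it compatible with equality almost everywhere. Both the rotations of the
  fibres and the weighted compositions are obtained in this way.\<close>

lemma lift_isometry:
  fixes A :: "(nat \<Rightarrow> real \<Rightarrow> 'k) \<Rightarrow> nat \<Rightarrow> real \<Rightarrow> 'k::{real_normed_field,second_countable_topology}"
  assumes n: "n > 0" and p: "1 \<le> p"
    and meas: "\<And>F i. (\<And>i. i < n \<Longrightarrow> F i \<in> borel_measurable \<lambda>\<^sub>0\<^sub>1) \<Longrightarrow> i < n \<Longrightarrow> A F i \<in> borel_measurable \<lambda>\<^sub>0\<^sub>1"
    and cong: "\<And>F G i. (\<And>i. i < n \<Longrightarrow> AE t in \<lambda>\<^sub>0\<^sub>1. F i t = G i t) \<Longrightarrow> i < n \<Longrightarrow> AE t in \<lambda>\<^sub>0\<^sub>1. A F i t = A G i t"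
    and add: "\<And>F G i t. i < n \<Longrightarrow> A (\<lambda>i t. F i t + G i t) i t = A F i t + A G i t"
    and scale: "\<And>c F i t. i < n \<Longrightarrow> A (\<lambda>i t. c * F i t) i t = c * A F i t"
    and int: "\<And>F. (\<And>i. i < n \<Longrightarrow> F i \<in> borel_measurable \<lambda>\<^sub>0\<^sub>1) \<Longrightarrow>
      integrable \<lambda>\<^sub>0\<^sub>1 (\<lambda>t. vnorm n (\<lambda>i. A F i t) powr p) \<longleftrightarrow> integrable \<lambda>\<^sub>0\<^sub>1 (\<lambda>t. vnorm n (\<lambda>i. F i t) powr p)"
    and iso: "\<And>F. (\<And>i. i < n \<Longrightarrow> F i \<in> borel_measurable \<lambda>\<^sub>0\<^sub>1) \<Longrightarrow>
      integrable \<lambda>\<^sub>0\<^sub>1 (\<lambda>t. vnorm n (\<lambda>i. F i t) powr p) \<Longrightarrow>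
      (LINT t|\<lambda>\<^sub>0\<^sub>1. vnorm n (\<lambda>i. A F i t) powr p) = (LINT t|\<lambda>\<^sub>0\<^sub>1. vnorm n (\<lambda>i. F i t) powr p)"
    and surj: "\<And>G. (\<And>i. i < n \<Longrightarrow> G i \<in> borel_measurable \<lambda>\<^sub>0\<^sub>1) \<Longrightarrow>
      \<exists>F. (\<forall>i<n. F i \<in> borel_measurable \<lambda>\<^sub>0\<^sub>1) \<and> (\<forall>i<n. AE t in \<lambda>\<^sub>0\<^sub>1. A F i t = G i t)"
  obtains T where "surj_linear_isometry_on (Lp p) (mixed_norm p n) T"
    "\<And>x i. i < n \<Longrightarrow> AE t in \<lambda>\<^sub>0\<^sub>1. coord n (T x) i t = A (coord n x) i t"
proof
  define T where "T x = glue_L0 n (A (coord n x))" for x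
  show T: "AE t in \<lambda>\<^sub>0\<^sub>1. coord n (T x) i t = A (coord n x) i t" if "i < n" for x i
    unfolding T_def using that by (intro coord_glue_L0 meas coord_measurable)
  have eqI: "x = y" if "\<And>i. i < n \<Longrightarrow> AE t in \<lambda>\<^sub>0\<^sub>1. coord n x i t = coord n y i t" for x y :: "'k L0"
    using that by (simp add: L0_eq_iff_coord[OF n])
  have lin: "linear_on (Lp p) T"
    unfolding linear_on_def
  proof (intro conjI ballI allI eqI)
    fix x y :: "'k L0" and i assume i: "i < n"
    have "AE t in \<lambda>\<^sub>0\<^sub>1. A (coord n (x + y)) i t = A (\<lambda>i t. coord n x i t + coord n y i t) i t"
      using i by (intro cong coord_add)
    with T[OF i, of "x + y"] T[OF i, of x] T[OF i, of y] coord_add[OF i, of "T x" "T y"]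
    show "AE t in \<lambda>\<^sub>0\<^sub>1. coord n (T (x + y)) i t = coord n (T x + T y) i t"
      by eventually_elim (simp add: add[OF i])
  next
    fix c :: 'k and x :: "'k L0" and i assume i: "i < n"
    have "AE t in \<lambda>\<^sub>0\<^sub>1. A (coord n (scale_L0 c x)) i t = A (\<lambda>i t. c * coord n x i t) i t"
      using i by (intro cong coord_scale)
    with T[OF i, of "scale_L0 c x"] T[OF i, of x] coord_scale[OF i, of c "T x"]
    show "AE t in \<lambda>\<^sub>0\<^sub>1. coord n (T (scale_L0 c x)) i t = coord n (scale_L0 c (T x)) i t"
      by eventually_elim (simp add: scale[OF i])
  qed
  have fn: "AE t in \<lambda>\<^sub>0\<^sub>1. fibre_norm n (T x) t powr p = vnorm n (\<lambda>i. A (coord n x) i t) powr p" for x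
  proof -
    have "AE t in \<lambda>\<^sub>0\<^sub>1. fibre_norm n (T x) t = vnorm n (\<lambda>i. A (coord n x) i t)"
      by (rule fibre_norm_cong_AE) (rule T)
    then show ?thesis by eventually_elim simp
  qed
  have m [measurable]: "(\<lambda>t. vnorm n (\<lambda>i. A (coord n x) i t)) \<in> borel_measurable \<lambda>\<^sub>0\<^sub>1" for x
    by (intro vnorm_measurable meas coord_measurable)
  have in_iff: "T x \<in> Lp p \<longleftrightarrow> x \<in> Lp p" for x
  proof -
    have "T x \<in> Lp p \<longleftrightarrow> integrable \<lambda>\<^sub>0\<^sub>1 (\<lambda>t. vnorm n (\<lambda>i. A (coord n x) i t) powr p)"
      unfolding Lp_iff_fibre_norm[OF n p] by (intro integrable_cong_AE fn) measurable
    also have "\<dots> \<longleftrightarrow> x \<in> Lp p"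
      unfolding Lp_iff_fibre_norm[OF n p] fibre_norm_def by (intro int coord_measurable)
    finally show ?thesis .
  qed
  have N: "mixed_norm p n (T x) = mixed_norm p n x" if "x \<in> Lp p" for x
  proof -
    have "mixed_mod p n (T x) = (LINT t|\<lambda>\<^sub>0\<^sub>1. vnorm n (\<lambda>i. A (coord n x) i t) powr p)"
      unfolding mixed_mod_def by (intro integral_cong_AE fn) measurable
    also have "\<dots> = mixed_mod p n x"
      using that unfolding mixed_mod_def fibre_norm_def Lp_iff_fibre_norm[OF n p]
      by (intro iso coord_measurable)
    finally show ?thesis by (simp add: mixed_norm_def)
  qed
  \<comment> \<open>The preimage from \<open>surj\<close> is merely measurable;
    \<open>in_iff\<close> shows that it belongs to \<open>Lp p\<close>.\<close>
  have "y \<in> T ` Lp p" if "y \<in> Lp p" for y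
  proof -
    obtain F where F: "\<And>i. i < n \<Longrightarrow> F i \<in> borel_measurable \<lambda>\<^sub>0\<^sub>1"
      "\<And>i. i < n \<Longrightarrow> AE t in \<lambda>\<^sub>0\<^sub>1. A F i t = coord n y i t"
      using surj[of "coord n y"] coord_measurable by blast
    let ?x = "glue_L0 n F"
    have "T ?x = y"
    proof (rule eqI)
      fix i assume i: "i < n"
      have "AE t in \<lambda>\<^sub>0\<^sub>1. A (coord n ?x) i t = A F i t" using i F(1) by (intro cong coord_glue_L0)
      with T[OF i, of ?x] F(2)[OF i]
      show "AE t in \<lambda>\<^sub>0\<^sub>1. coord n (T ?x) i t = coord n y i t" by eventually_elim simp
    qed
    then show ?thesis using in_iff that by (metis imageI)
  qed
  then have "T ` Lp p = Lp p" using in_iff by auto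
  then show "surj_linear_isometry_on (Lp p) (mixed_norm p n) T"
    using lin N by (simp add: surj_linear_isometry_on_def)
qed

text \<open>For \<open>w = 0\<close> the division by zero yields \<open>0\<close>, and the map is the identity.\<close>

definition householder :: "nat \<Rightarrow> (nat \<Rightarrow> real) \<Rightarrow> (nat \<Rightarrow> 'k::real_vector) \<Rightarrow> nat \<Rightarrow> 'k"
  where "householder n w v i = v i - (2 * w i / (\<Sum>j<n. (w j)\<^sup>2)) *\<^sub>R (\<Sum>j<n. w j *\<^sub>R v j)"

text \<open>With \<open>s\<close> the weighted sum of the \<open>v j\<close> and \<open>q\<close>
  the squared length of \<open>w\<close>, expanding the squares produces the corrections
  \<open>- (4 / q) * (s \<bullet> s)\<close> and
  \<open>(4 / q\<^sup>2) * q * (s \<bullet> s)\<close>, which cancel. For \<open>q = 0\<close> both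
  are zero.\<close>

lemma vnorm_householder: "vnorm n (householder n w v) = vnorm n v" for v :: "nat \<Rightarrow> 'k::real_inner"
proof -
  define q where "q = (\<Sum>j<n. (w j)\<^sup>2)"
  define s where "s = (\<Sum>j<n. w j *\<^sub>R v j)"
  have "(vnorm n (householder n w v))\<^sup>2 = (\<Sum>i<n. (norm (v i))\<^sup>2 - (4 / q) * (w i *\<^sub>R v i \<bullet> s) + (4 / q\<^sup>2) * (w i)\<^sup>2 * (s \<bullet> s))"
    unfolding vnorm_power2
  proof (intro sum.cong refl)
    fix i
    have *: "(norm (x - c *\<^sub>R y))\<^sup>2 = (norm x)\<^sup>2 - 2 * c * (x \<bullet> y) + c\<^sup>2 * (y \<bullet> y)" for x y :: 'k and c
      by (simp add: power2_norm_eq_inner inner_diff inner_commute) (simp add: power2_eq_square)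
    show "(norm (householder n w v i))\<^sup>2 = (norm (v i))\<^sup>2 - (4 / q) * (w i *\<^sub>R v i \<bullet> s) + (4 / q\<^sup>2) * (w i)\<^sup>2 * (s \<bullet> s)"
      unfolding householder_def q_def[symmetric] s_def[symmetric]
      by (simp add: * power_divide power_mult_distrib)
  qed
  also have "\<dots> = (vnorm n v)\<^sup>2 - (4 / q) * (s \<bullet> s) + (4 / q\<^sup>2) * q * (s \<bullet> s)"
    unfolding sum.distrib sum_subtractf vnorm_power2 sum_distrib_left[symmetric] sum_distrib_right[symmetric]
      inner_sum_left[symmetric] s_def[symmetric] q_def[symmetric] ..
  also have "\<dots> = (vnorm n v)\<^sup>2" by (simp add: power2_eq_square)
  finally show ?thesis by simp
qed

text \<open>If \<open>q\<close> is nonzero, the weighted sum of the reflected vector is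
  \<open>- s\<close>, so the second reflection restores what the first one subtracted.\<close>

lemma householder_involution:
  assumes "i < n"
  shows "householder n w (householder n w v) i = v i"
proof -
  define q where "q = (\<Sum>j<n. (w j)\<^sup>2)"
  define s where "s = (\<Sum>j<n. w j *\<^sub>R v j)"
  have "(\<Sum>j<n. w j *\<^sub>R householder n w v j) = (\<Sum>j<n. w j *\<^sub>R v j - ((2 / q) * (w j)\<^sup>2) *\<^sub>R s)"
    unfolding householder_def q_def[symmetric] s_def[symmetric]
    by (intro sum.cong) (auto simp: scaleR_diff_right power2_eq_square)
  also have "\<dots> = s - ((2 / q) * q) *\<^sub>R s"
    unfolding sum_subtractf s_def[symmetric] scaleR_left.sum[symmetric] sum_distrib_left[symmetric] q_def[symmetric] ..
  finally have *: "(\<Sum>j<n. w j *\<^sub>R householder n w v j) = s - ((2 / q) * q) *\<^sub>R s" .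
  have "householder n w (householder n w v) i = v i - (2 * w i / q) *\<^sub>R s - (2 * w i / q) *\<^sub>R (s - ((2 / q) * q) *\<^sub>R s)"
    unfolding householder_def[of n w "householder n w v"] * q_def[symmetric]
    by (simp add: householder_def q_def s_def)
  also have "\<dots> = v i"
    by (cases "q = 0") (auto simp: scaleR_diff_right scaleR_2)
  finally show ?thesis .
qed

lemma householder_cong: "(\<And>i. i < n \<Longrightarrow> v i = v' i) \<Longrightarrow> i < n \<Longrightarrow> householder n w v i = householder n w v' i"
  by (simp add: householder_def)

text \<open>The value 1 at \<open>a = 0\<close> keeps multiplication by the phase isometric and
  invertible.\<close>

definition phase :: "'k::real_normed_field \<Rightarrow> 'k"
  where "phase a = (if a = 0 then 1 else of_real (norm a) / a)"

lemma norm_phase [simp]: "norm (phase a) = 1"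
  by (simp add: phase_def norm_divide)

lemma phase_nonzero [simp]: "phase a \<noteq> 0"
  by (simp add: phase_def)

lemma phase_mult: "phase a * a = of_real (norm a)"
  by (simp add: phase_def)

text \<open>The Householder reflection along this vector takes \<open>(|a\<^sub>0|, \<dots>, |a\<^sub>n\<^sub>-\<^sub>1|)\<close> to \<open>(|a|, 0, \<dots>, 0)\<close>.\<close>

definition defect :: "nat \<Rightarrow> (nat \<Rightarrow> 'k::real_normed_vector) \<Rightarrow> nat \<Rightarrow> real"
  where "defect n a i = norm (a i) - (if i = 0 then vnorm n a else 0)"

text \<open>Reflection along the difference of two real vectors of equal length exchanges them. In
  terms of sums: the squared length of the difference is twice its inner product with the vector of
  moduli.\<close>

lemma householder_defect:
  fixes a :: "nat \<Rightarrow> 'k::real_normed_field"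
  assumes "i < n"
  shows "householder n (defect n a) (\<lambda>j. of_real (norm (a j)) :: 'k) i = (if i = 0 then of_real (vnorm n a) else 0)"
proof -
  let ?r = "vnorm n a" and ?w = "defect n a"
  have n: "n > 0" using assms by simp
  have d: "(\<Sum>j<n. (if j = 0 then ?r else 0) * norm (a j)) = ?r * norm (a 0)"
    using n by (simp add: if_distrib[of "\<lambda>x. x * _"] sum.delta cong: if_cong)
  have dd: "(\<Sum>j<n. ((if j = 0 then ?r else 0) :: real)\<^sup>2) = ?r\<^sup>2"
    using n by (simp add: if_distrib[of "\<lambda>x. x\<^sup>2"] sum.delta cong: if_cong)
  have s: "(\<Sum>j<n. ?w j * norm (a j)) = ?r\<^sup>2 - ?r * norm (a 0)"
    unfolding defect_def left_diff_distrib sum_subtractf d by (simp flip: power2_eq_square vnorm_power2)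
  have q: "(\<Sum>j<n. (?w j)\<^sup>2) = 2 * (?r\<^sup>2 - ?r * norm (a 0))"
  proof -
    have "(\<Sum>j<n. (?w j)\<^sup>2) = (\<Sum>j<n. (norm (a j))\<^sup>2 + (if j = 0 then ?r else 0)\<^sup>2 - 2 * ((if j = 0 then ?r else 0) * norm (a j)))"
      by (intro sum.cong) (auto simp: defect_def power2_diff)
    also have "\<dots> = ?r\<^sup>2 + ?r\<^sup>2 - 2 * (?r * norm (a 0))"
      unfolding sum_subtractf sum.distrib sum_distrib_left[symmetric] d dd by (simp add: vnorm_power2)
    finally show ?thesis by simp
  qed
  have sk: "(\<Sum>j<n. ?w j *\<^sub>R (of_real (norm (a j)) :: 'k)) = of_real (\<Sum>j<n. ?w j * norm (a j))"
    by (simp add: scaleR_conv_of_real)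
  have "householder n ?w (\<lambda>j. of_real (norm (a j)) :: 'k) i =
    of_real (norm (a i) - 2 * ?w i / (2 * (?r\<^sup>2 - ?r * norm (a 0))) * (?r\<^sup>2 - ?r * norm (a 0)))"
    unfolding householder_def sk s q by (simp add: scaleR_conv_of_real)
  also have "norm (a i) - 2 * ?w i / (2 * (?r\<^sup>2 - ?r * norm (a 0))) * (?r\<^sup>2 - ?r * norm (a 0)) = (if i = 0 then ?r else 0)"
  proof (cases "?r\<^sup>2 - ?r * norm (a 0) = 0")
    \<comment> \<open>A zero denominator means that the defect vanishes, so the vector of moduli is
      already the target.\<close>
    case True
    then have "\<forall>j\<in>{..<n}. (?w j)\<^sup>2 = 0" using q by (subst sum_nonneg_eq_0_iff[symmetric]) auto
    then have "?w i = 0" using assms by simp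
    then show ?thesis by (auto simp: defect_def split: if_splits)
  next
    case False
    have "2 * w / (2 * D) * D = w" if "D \<noteq> 0" for w D :: real using that by simp
    from this[OF False] show ?thesis by (simp only: defect_def)
  qed
  finally show ?thesis by auto
qed

text \<open>Multiplying by phases turns the coordinates of \<open>x\<close> into their moduli, and
  the reflection moves the length into the first component. Both are explicit expressions in the
  coordinates of \<open>x\<close>, hence measurable in \<open>t\<close>, and being real reflections
  and multiplications they are linear over the scalar field.\<close>

lemma rotation_isometry:
  fixes x :: "'k::{real_normed_field,euclidean_space} L0"
  assumes n: "n > 0" and p: "1 \<le> p"
  obtains T where "surj_linear_isometry_on (Lp p) (mixed_norm p n) (T :: 'k L0 \<Rightarrow> 'k L0)"
    "\<And>i. i < n \<Longrightarrow> AE t in \<lambda>\<^sub>0\<^sub>1. coord n (T x) i t = (if i = 0 then of_real (fibre_norm n x t) else 0)"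
proof -
  let ?w = "\<lambda>t. defect n (\<lambda>i. coord n x i t)"
  let ?u = "\<lambda>t j. phase (coord n x j t)"
  let ?A = "\<lambda>(F::nat \<Rightarrow> real \<Rightarrow> 'k) i t. householder n (?w t) (\<lambda>j. ?u t j * F j t) i"
  have cm [measurable]: "coord n x i \<in> borel_measurable \<lambda>\<^sub>0\<^sub>1" if "i < n" for i
    using that by (rule coord_measurable)
  have vm [measurable]: "(\<lambda>t. vnorm n (\<lambda>i. coord n x i t)) \<in> borel_measurable \<lambda>\<^sub>0\<^sub>1"
    by (intro vnorm_measurable cm)
  have wm [measurable]: "(\<lambda>t. ?w t i) \<in> borel_measurable \<lambda>\<^sub>0\<^sub>1" if "i < n" for i
    using that unfolding defect_def by measurable
  have um [measurable]: "(\<lambda>t. ?u t i) \<in> borel_measurable \<lambda>\<^sub>0\<^sub>1" if "i < n" for i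
    using that unfolding phase_def by measurable
  have hm: "(\<lambda>t. householder n (?w t) (\<lambda>j. F j t) i) \<in> borel_measurable \<lambda>\<^sub>0\<^sub>1"
    if [measurable]: "\<And>i. i < n \<Longrightarrow> F i \<in> borel_measurable \<lambda>\<^sub>0\<^sub>1" and [simp]: "i < n" for F :: "nat \<Rightarrow> real \<Rightarrow> 'k" and i
    unfolding householder_def by measurable
  have vA: "vnorm n (\<lambda>i. ?A F i t) = vnorm n (\<lambda>i. F i t)" for F t
    using vnorm_householder[of n "?w t" "\<lambda>j. ?u t j * F j t"] by (simp add: vnorm_def norm_mult)
  obtain T where T: "surj_linear_isometry_on (Lp p) (mixed_norm p n) (T :: 'k L0 \<Rightarrow> 'k L0)"
    "\<And>y i. i < n \<Longrightarrow> AE t in \<lambda>\<^sub>0\<^sub>1. coord n (T y) i t = ?A (coord n y) i t"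
  proof (rule lift_isometry[OF n p, of ?A])
    fix F :: "nat \<Rightarrow> real \<Rightarrow> 'k" and i
    assume [measurable]: "\<And>i. i < n \<Longrightarrow> F i \<in> borel_measurable \<lambda>\<^sub>0\<^sub>1" and i: "i < n"
    have "(\<lambda>t. ?u t j * F j t) \<in> borel_measurable \<lambda>\<^sub>0\<^sub>1" if "j < n" for j using that by measurable
    then show "?A F i \<in> borel_measurable \<lambda>\<^sub>0\<^sub>1" using i by (rule hm)
  next
    fix F G :: "nat \<Rightarrow> real \<Rightarrow> 'k" and i
    assume eq: "\<And>i. i < n \<Longrightarrow> AE t in \<lambda>\<^sub>0\<^sub>1. F i t = G i t" and i: "i < n"
    then have "AE t in \<lambda>\<^sub>0\<^sub>1. \<forall>i<n. F i t = G i t" by (simp add: AE_all_less)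
    then show "AE t in \<lambda>\<^sub>0\<^sub>1. ?A F i t = ?A G i t"
      by eventually_elim (use i in \<open>auto intro!: householder_cong\<close>)
  next
    fix G :: "nat \<Rightarrow> real \<Rightarrow> 'k"
    assume G: "\<And>i. i < n \<Longrightarrow> G i \<in> borel_measurable \<lambda>\<^sub>0\<^sub>1"
    \<comment> \<open>The reflection is its own inverse and the phases are undone by
      division.\<close>
    let ?F = "\<lambda>i t. householder n (?w t) (\<lambda>j. G j t) i / ?u t i"
    have "?A ?F i t = G i t" if "i < n" for i t
      using householder_involution[OF that, of "?w t" "\<lambda>j. G j t"] by simp
    moreover have "?F i \<in> borel_measurable \<lambda>\<^sub>0\<^sub>1" if i: "i < n" for i
      using hm[OF G i] um[OF i] by measurable
    ultimately show "\<exists>F. (\<forall>i<n. F i \<in> borel_measurable \<lambda>\<^sub>0\<^sub>1) \<and> (\<forall>i<n. AE t in \<lambda>\<^sub>0\<^sub>1. ?A F i t = G i t)"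
      by (intro exI[of _ ?F]) auto
  next
    fix F G :: "nat \<Rightarrow> real \<Rightarrow> 'k" and i t
    show "?A (\<lambda>i t. F i t + G i t) i t = ?A F i t + ?A G i t"
      by (simp add: householder_def algebra_simps sum.distrib)
  next
    fix c and F :: "nat \<Rightarrow> real \<Rightarrow> 'k" and i t
    show "?A (\<lambda>i t. c * F i t) i t = c * ?A F i t"
      by (simp add: householder_def algebra_simps sum_distrib_left)
  qed (simp_all add: vA)
  have "AE t in \<lambda>\<^sub>0\<^sub>1. coord n (T x) i t = (if i = 0 then of_real (fibre_norm n x t) else 0)" if i: "i < n" for i
    using T(2)[OF i, of x]
  proof eventually_elim
    case (elim t)
    then show ?case using householder_defect[OF i, of "\<lambda>i. coord n x i t"]
      by (simp add: phase_mult fibre_norm_def)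
  qed
  with T(1) show ?thesis by (rule that)
qed

section \<open>Constant functions and weighted compositions\<close>

definition const_L0 :: "nat \<Rightarrow> (nat \<Rightarrow> 'k) \<Rightarrow> 'k::{real_normed_field,second_countable_topology} L0"
  where "const_L0 n c = glue_L0 n (\<lambda>i t. c i)"

abbreviation unit_L0 :: "nat \<Rightarrow> 'k::{real_normed_field,second_countable_topology} L0"
  where "unit_L0 n \<equiv> const_L0 n (\<lambda>i. if i = 0 then 1 else 0)"

lemma coord_const_L0: "i < n \<Longrightarrow> AE t in \<lambda>\<^sub>0\<^sub>1. coord n (const_L0 n c) i t = c i"
  unfolding const_L0_def by (rule coord_glue_L0) auto

lemma fibre_norm_const_L0: "AE t in \<lambda>\<^sub>0\<^sub>1. fibre_norm n (const_L0 n c) t = vnorm n c"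
  by (rule fibre_norm_cong_AE[OF coord_const_L0])

lemma const_L0_Lp:
  assumes n: "n > 0" and p: "1 \<le> p"
  shows "const_L0 n c \<in> Lp p"
proof -
  interpret finite_measure "\<lambda>\<^sub>0\<^sub>1" by (rule finite_measure_unit_interval)
  have "integrable \<lambda>\<^sub>0\<^sub>1 (\<lambda>t. fibre_norm n (const_L0 n c) t powr p)"
    using fibre_norm_const_L0[of n c]
    by (intro integrable_const_bound[where B = "vnorm n c powr p"]) (auto elim: eventually_mono)
  then show ?thesis by (simp add: Lp_iff_fibre_norm[OF n p])
qed

text \<open>The weight compensates the change of variables: \<open>h\<close> contributes the factor
  \<open>h powr p\<close> to the \<open>p\<close>-th power of the fibre norm, and this is the
  derivative of \<open>?\<phi>\<close>. On a constant function composition has no effect and only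
  the weight remains.\<close>

lemma weighted_composition_isometry:
  fixes h :: "real \<Rightarrow> real"
  assumes n: "n > 0" and p: "1 \<le> p"
    and hc: "continuous_on {0..1} h" and h0': "\<forall>t\<in>{0..1}. h t > 0" and h1: "(LINT t|\<lambda>\<^sub>0\<^sub>1. h t powr p) = 1"
  obtains T where "surj_linear_isometry_on (Lp p) (mixed_norm p n)
      (T :: 'k::{real_normed_field,second_countable_topology} L0 \<Rightarrow> 'k L0)"
    "\<And>i. i < n \<Longrightarrow> AE t in \<lambda>\<^sub>0\<^sub>1. coord n (T (unit_L0 n)) i t = (if i = 0 then of_real (h t) else 0)"
proof -
  note h0 = bspec[OF h0']
  let ?q = "\<lambda>t. h t powr p"
  let ?\<phi> = "\<lambda>t. integral {0..t} ?q"
  have qc: "continuous_on {0..1} ?q"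
    using hc h0 by (intro continuous_intros) (auto simp: less_imp_neq[symmetric])
  then have "integrable \<lambda>\<^sub>0\<^sub>1 ?q" by (rule continuous_imp_integrable_real)
  then have q1: "integral {0..1} ?q = 1" using h1 by (simp add: lebesgue_integral_eq_integral)
  interpret interval_diffeo 0 1 0 1 ?\<phi> ?q
    using h0 by (intro indefinite_integral_diffeo qc q1) (auto simp: less_imp_neq[symmetric])
  have hm [measurable]: "h \<in> borel_measurable \<lambda>\<^sub>0\<^sub>1"
    using hc by (intro continuous_imp_measurable_on_sets_lebesgue) auto
  let ?A = "\<lambda>(F::nat \<Rightarrow> real \<Rightarrow> 'k) i t. of_real (h t) * F i (?\<phi> t)"
  have comp: "(\<lambda>t. F (?\<phi> t)) \<in> borel_measurable \<lambda>\<^sub>0\<^sub>1" if "F \<in> borel_measurable \<lambda>\<^sub>0\<^sub>1" for F :: "real \<Rightarrow> 'k"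
    using that by (simp add: borel_measurable_comp_iff)
  have vA: "vnorm n (\<lambda>i. ?A F i t) powr p = ?q t * vnorm n (\<lambda>i. F i (?\<phi> t)) powr p" if "t \<in> {0..1}" for F t
    using h0[OF that] by (simp add: vnorm_mult powr_mult)
  have int_eq: "integrable \<lambda>\<^sub>0\<^sub>1 (\<lambda>t. vnorm n (\<lambda>i. ?A F i t) powr p) \<longleftrightarrow> integrable \<lambda>\<^sub>0\<^sub>1 (\<lambda>t. vnorm n (\<lambda>i. F i t) powr p)"
    and lint_eq: "integrable \<lambda>\<^sub>0\<^sub>1 (\<lambda>t. vnorm n (\<lambda>i. F i t) powr p) \<Longrightarrow>
      (LINT t|\<lambda>\<^sub>0\<^sub>1. vnorm n (\<lambda>i. ?A F i t) powr p) = (LINT t|\<lambda>\<^sub>0\<^sub>1. vnorm n (\<lambda>i. F i t) powr p)" for F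
  proof -
    let ?f = "\<lambda>s. vnorm n (\<lambda>i. F i s) powr p"
    have "integrable \<lambda>\<^sub>0\<^sub>1 (\<lambda>t. vnorm n (\<lambda>i. ?A F i t) powr p) \<longleftrightarrow> integrable \<lambda>\<^sub>0\<^sub>1 (\<lambda>t. ?q t * ?f (?\<phi> t))"
      by (intro Bochner_Integration.integrable_cong refl vA) simp
    then show "integrable \<lambda>\<^sub>0\<^sub>1 (\<lambda>t. vnorm n (\<lambda>i. ?A F i t) powr p) \<longleftrightarrow> integrable \<lambda>\<^sub>0\<^sub>1 ?f"
      using integral_change(1)[of ?f] by simp
    have "(LINT t|\<lambda>\<^sub>0\<^sub>1. vnorm n (\<lambda>i. ?A F i t) powr p) = (LINT t|\<lambda>\<^sub>0\<^sub>1. ?q t * ?f (?\<phi> t))"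
      by (intro Bochner_Integration.integral_cong refl vA) simp
    then show "(LINT t|\<lambda>\<^sub>0\<^sub>1. vnorm n (\<lambda>i. ?A F i t) powr p) = (LINT t|\<lambda>\<^sub>0\<^sub>1. ?f t)" if "integrable \<lambda>\<^sub>0\<^sub>1 ?f"
      using integral_change(2)[OF that] by simp
  qed
  have hk [measurable]: "(\<lambda>t. of_real (h t) :: 'k) \<in> borel_measurable \<lambda>\<^sub>0\<^sub>1"
    by (rule measurable_compose[OF hm borel_measurable_of_real])
  obtain T where T: "surj_linear_isometry_on (Lp p) (mixed_norm p n) (T :: 'k L0 \<Rightarrow> 'k L0)"
    "\<And>y i. i < n \<Longrightarrow> AE t in \<lambda>\<^sub>0\<^sub>1. coord n (T y) i t = ?A (coord n y) i t"
  proof (rule lift_isometry[OF n p, of ?A])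
    fix F :: "nat \<Rightarrow> real \<Rightarrow> 'k" and i
    assume "\<And>i. i < n \<Longrightarrow> F i \<in> borel_measurable \<lambda>\<^sub>0\<^sub>1" and "i < n"
    then show "?A F i \<in> borel_measurable \<lambda>\<^sub>0\<^sub>1" by (intro borel_measurable_times hk comp) auto
  next
    fix F G :: "nat \<Rightarrow> real \<Rightarrow> 'k" and i
    assume eq: "\<And>i. i < n \<Longrightarrow> AE t in \<lambda>\<^sub>0\<^sub>1. F i t = G i t" and i: "i < n"
    have "AE t in \<lambda>\<^sub>0\<^sub>1. F i (?\<phi> t) = G i (?\<phi> t)" using eq[OF i] by (subst AE_comp_iff)
    then show "AE t in \<lambda>\<^sub>0\<^sub>1. ?A F i t = ?A G i t" by eventually_elim simp
  next
    fix G :: "nat \<Rightarrow> real \<Rightarrow> 'k"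
    assume G: "\<And>i. i < n \<Longrightarrow> G i \<in> borel_measurable \<lambda>\<^sub>0\<^sub>1"
    let ?\<psi> = "inv_into {0..1} ?\<phi>"
    let ?F = "\<lambda>i s. G i (?\<psi> s) / of_real (h (?\<psi> s))"
    have inv: "?\<psi> (?\<phi> t) = t" if "t \<in> {0..1}" for t by (rule inv_into_f_f[OF inj that])
    have "?F i \<in> borel_measurable \<lambda>\<^sub>0\<^sub>1" if i: "i < n" for i
    proof -
      \<comment> \<open>Measurability of \<open>?F i\<close> is tested after composition with
        \<open>?\<phi>\<close>, where the inverse map disappears.\<close>
      have "(\<lambda>t. G i t / of_real (h t)) \<in> borel_measurable \<lambda>\<^sub>0\<^sub>1" using G[OF i] by measurable
      also have "?this \<longleftrightarrow> (\<lambda>t. ?F i (?\<phi> t)) \<in> borel_measurable \<lambda>\<^sub>0\<^sub>1"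
        by (intro measurable_cong) (simp add: inv)
      finally show ?thesis by (rule iffD1[OF borel_measurable_comp_iff[of "?F i"]])
    qed
    moreover have "AE t in \<lambda>\<^sub>0\<^sub>1. ?A ?F i t = G i t" for i
      using AE_space by eventually_elim (use h0 in \<open>auto simp: inv less_imp_neq[symmetric]\<close>)
    ultimately show "\<exists>F. (\<forall>i<n. F i \<in> borel_measurable \<lambda>\<^sub>0\<^sub>1) \<and> (\<forall>i<n. AE t in \<lambda>\<^sub>0\<^sub>1. ?A F i t = G i t)"
      by (intro exI[of _ ?F]) auto
  qed (auto simp: int_eq lint_eq algebra_simps)
  have "AE t in \<lambda>\<^sub>0\<^sub>1. coord n (T (unit_L0 n)) i t = (if i = 0 then of_real (h t) else 0)" if i: "i < n" for i
  proof -
    have "AE t in \<lambda>\<^sub>0\<^sub>1. coord n (unit_L0 n) i (?\<phi> t) = (if i = 0 then 1 else 0 :: 'k)"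
      using coord_const_L0[OF i] by (subst AE_comp_iff)
    with T(2)[OF i, of "unit_L0 n"] show ?thesis by eventually_elim auto
  qed
  with T(1) show ?thesis by (rule that)
qed

text \<open>A rotation \<open>R\<close> turns \<open>x\<close> into its fibre norm placed in the
  first component, and a weighted composition \<open>W\<close> turns the unit function into the
  approximation \<open>h\<close> placed there. The isometry is \<open>W\<close> followed by the
  inverse \<open>S\<close> of \<open>R\<close>.\<close>

lemma orbit_of_unit_dense:
  fixes x :: "'k::{real_normed_field,euclidean_space} L0"
  assumes n: "n > 0" and p: "1 \<le> p" and x: "x \<in> Lp p" "mixed_norm p n x = 1" and e: "\<epsilon> > 0"
  obtains T where "surj_linear_isometry_on (Lp p) (mixed_norm p n) T" "mixed_norm p n (x - T (unit_L0 n)) \<le> \<epsilon>"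
proof -
  have "(mixed_mod p n x powr (1 / p)) powr p = 1" using x(2) by (simp add: mixed_norm_def)
  then have one: "(LINT t|\<lambda>\<^sub>0\<^sub>1. fibre_norm n x t powr p) = 1"
    using p by (simp add: powr_powr mixed_mod_def)
  have fi: "integrable \<lambda>\<^sub>0\<^sub>1 (\<lambda>t. fibre_norm n x t powr p)"
    using x(1) by (simp only: Lp_iff_fibre_norm[OF n p])
  obtain h where h: "continuous_on {0..1} h" "\<forall>t\<in>{0..1}. h t > 0"
    "(LINT t|\<lambda>\<^sub>0\<^sub>1. h t powr p) = 1" "Lp_seminorm p (\<lambda>t. fibre_norm n x t - h t) \<le> \<epsilon>"
    using continuous_positive_approximation[of p "fibre_norm n x" \<epsilon>, OF p fibre_norm_measurable fibre_norm_nonneg fi one e]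
    by blast
  obtain R where R: "surj_linear_isometry_on (Lp p) (mixed_norm p n) (R :: 'k L0 \<Rightarrow> 'k L0)"
    "\<And>i. i < n \<Longrightarrow> AE t in \<lambda>\<^sub>0\<^sub>1. coord n (R x) i t = (if i = 0 then of_real (fibre_norm n x t) else 0)"
    using rotation_isometry[OF n p, of x] by blast
  obtain W where W: "surj_linear_isometry_on (Lp p) (mixed_norm p n) (W :: 'k L0 \<Rightarrow> 'k L0)"
    "\<And>i. i < n \<Longrightarrow> AE t in \<lambda>\<^sub>0\<^sub>1. coord n (W (unit_L0 n)) i t = (if i = 0 then of_real (h t) else 0)"
    using weighted_composition_isometry[OF n p h(1-3)] by blast
  obtain S where S: "surj_linear_isometry_on (Lp p) (mixed_norm p n) S" "\<And>x. x \<in> Lp p \<Longrightarrow> R (S x) = x"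
    using surj_linear_isometry_on_inverse[OF n p R(1)] by metis
  let ?e = "unit_L0 n :: 'k L0"
  have We: "W ?e \<in> Lp p" using W(1) const_L0_Lp[OF n p] by (auto simp: surj_linear_isometry_on_def)
  have SWe: "S (W ?e) \<in> Lp p" using S(1) We by (auto simp: surj_linear_isometry_on_def)
  have "mixed_norm p n (x - S (W ?e)) = mixed_norm p n (R (x - S (W ?e)))"
    using R(1) Lp_diff[OF p x(1) SWe] by (simp add: surj_linear_isometry_on_def)
  also have "R (x - S (W ?e)) = R x - W ?e"
    using linear_on_diff[of "Lp p" R x "S (W ?e)", OF _ x(1) SWe Lp_scale[OF p]] R(1) S(2)[OF We]
    by (simp add: surj_linear_isometry_on_def)
  \<comment> \<open>Both functions have only a first component, so their distance is that of the
    scalar functions.\<close>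
  also have "mixed_norm p n (R x - W ?e) = Lp_seminorm p (\<lambda>t. fibre_norm n x t - h t)"
  proof -
    have vn: "vnorm n (\<lambda>i. if i = 0 then c else (0::'k)) = norm c" for c
    proof -
      have "(vnorm n (\<lambda>i. if i = 0 then c else (0::'k)))\<^sup>2 = (norm c)\<^sup>2"
        using n by (simp add: vnorm_power2 if_distrib[of "\<lambda>x. (norm x)\<^sup>2"] sum.delta cong: if_cong)
      then show ?thesis by simp
    qed
    have hm [measurable]: "h \<in> borel_measurable \<lambda>\<^sub>0\<^sub>1"
      using h(1) by (intro continuous_imp_measurable_on_sets_lebesgue) auto
    have "AE t in \<lambda>\<^sub>0\<^sub>1. coord n (R x - W ?e) i t = (if i = 0 then of_real (fibre_norm n x t - h t) else 0)" if "i < n" for i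
      using R(2)[OF that] W(2)[OF that] coord_diff[OF that, of "R x" "W ?e"] by eventually_elim auto
    then have "AE t in \<lambda>\<^sub>0\<^sub>1. fibre_norm n (R x - W ?e) t = vnorm n (\<lambda>i. if i = 0 then of_real (fibre_norm n x t - h t) else (0::'k))"
      by (rule fibre_norm_cong_AE)
    then have "AE t in \<lambda>\<^sub>0\<^sub>1. fibre_norm n (R x - W ?e) t powr p = \<bar>fibre_norm n x t - h t\<bar> powr p"
      by eventually_elim (simp only: vn norm_of_real)
    then have "mixed_mod p n (R x - W ?e) = (LINT t|\<lambda>\<^sub>0\<^sub>1. \<bar>fibre_norm n x t - h t\<bar> powr p)"
      unfolding mixed_mod_def by (intro integral_cong_AE) auto
    then show ?thesis by (simp add: mixed_norm_def Lp_seminorm_def)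
  qed
  also have "\<dots> \<le> \<epsilon>" by (rule h(4))
  finally show ?thesis
    using that[of "\<lambda>x. S (W x)"] surj_linear_isometry_on_comp[OF S(1) W(1)] by blast
qed

text \<open>Near \<open>x\<close> and near \<open>y\<close> there are images \<open>T ?e\<close> and
  \<open>S ?e\<close> of the unit function. The inverse \<open>T'\<close> of \<open>T\<close>
  followed by \<open>S\<close> connects these, and each of the two approximations costs half of
  \<epsilon>.\<close>

lemma almost_transitive_mixed_norm:
  assumes n: "n > 0" and p: "1 \<le> p"
  shows "almost_transitive_on (Lp p) (mixed_norm p n :: 'k::{real_normed_field,euclidean_space} L0 \<Rightarrow> real)"
  unfolding almost_transitive_on_def
proof (intro ballI allI impI)
  fix x y :: "'k L0" and \<epsilon> :: real
  assume x: "x \<in> Lp p" "mixed_norm p n x = 1" and y: "y \<in> Lp p" "mixed_norm p n y = 1" and e: "\<epsilon> > 0"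
  have e2: "\<epsilon> / 2 > 0" using e by simp
  let ?e = "unit_L0 n :: 'k L0"
  obtain T where T: "surj_linear_isometry_on (Lp p) (mixed_norm p n) T" "mixed_norm p n (x - T ?e) \<le> \<epsilon> / 2"
    using orbit_of_unit_dense[OF n p x e2] by blast
  obtain S where S: "surj_linear_isometry_on (Lp p) (mixed_norm p n) S" "mixed_norm p n (y - S ?e) \<le> \<epsilon> / 2"
    using orbit_of_unit_dense[OF n p y e2] by blast
  obtain T' where T': "surj_linear_isometry_on (Lp p) (mixed_norm p n) T'" "\<And>x. x \<in> Lp p \<Longrightarrow> T' (T x) = x"
    using surj_linear_isometry_on_inverse[OF n p T(1)] by metis
  have U: "surj_linear_isometry_on (Lp p) (mixed_norm p n) (\<lambda>x. S (T' x))"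
    by (rule surj_linear_isometry_on_comp[OF S(1) T'(1)])
  have eL: "?e \<in> Lp p" by (rule const_L0_Lp[OF n p])
  have Te: "T ?e \<in> Lp p" and Se: "S ?e \<in> Lp p"
    using T(1) S(1) eL by (auto simp: surj_linear_isometry_on_def)
  have xe: "x - T ?e \<in> Lp p" by (rule Lp_diff[OF p x(1) Te])
  \<comment> \<open>The intermediate point is \<open>S ?e\<close>, which equals
    \<open>S (T' (T ?e))\<close>.\<close>
  have eq: "y - S (T' x) = (y - S ?e) + scale_L0 (- 1) (S (T' (x - T ?e)))"
    using linear_on_diff[of "Lp p" "\<lambda>x. S (T' x)" x "T ?e", OF _ x(1) Te Lp_scale[OF p]] U T'(2)[OF eL]
    by (simp add: surj_linear_isometry_on_def scale_L0_minus_one)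
  have ST: "S (T' (x - T ?e)) \<in> Lp p" using U xe by (auto simp: surj_linear_isometry_on_def)
  have "mixed_norm p n (y - S (T' x)) \<le> mixed_norm p n (y - S ?e) + mixed_norm p n (scale_L0 (- 1) (S (T' (x - T ?e))))"
    unfolding eq using ST Se y(1) by (intro Lp_add_mixed_norm(2)[OF n p] Lp_diff[OF p] Lp_scale[OF p])
  also have "mixed_norm p n (scale_L0 (- 1) (S (T' (x - T ?e)))) = mixed_norm p n (x - T ?e)"
    using U xe by (simp add: mixed_norm_scale[OF p] surj_linear_isometry_on_def)
  finally have "mixed_norm p n (y - S (T' x)) \<le> \<epsilon>" using T(2) S(2) by simp
  with U show "\<exists>T. surj_linear_isometry_on (Lp p) (mixed_norm p n) T \<and> mixed_norm p n (y - T x) \<le> \<epsilon>"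
    by blast
qed

section \<open>Disjointness\<close>

text \<open>Writing \<open>x powr r\<close> as \<open>x * x powr (r - 1)\<close> reduces the claim
  to monotonicity of the second factor.\<close>

lemma powr_superadditive:
  fixes \<alpha> \<beta> r :: real
  assumes "1 < r" "0 \<le> \<alpha>" "0 \<le> \<beta>"
  shows "\<alpha> powr r + \<beta> powr r \<le> (\<alpha> + \<beta>) powr r"
    and "\<alpha> > 0 \<Longrightarrow> \<beta> > 0 \<Longrightarrow> \<alpha> powr r + \<beta> powr r < (\<alpha> + \<beta>) powr r"
proof -
  show *: "\<alpha> powr r + \<beta> powr r < (\<alpha> + \<beta>) powr r" if "\<alpha> > 0" "\<beta> > 0"
  proof -
    have e: "x powr r = x * x powr (r - 1)" if "x > 0" for x :: real
      using that by (simp add: powr_mult_base)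
    have "\<alpha> * \<alpha> powr (r - 1) < \<alpha> * (\<alpha> + \<beta>) powr (r - 1)"
      using that assms by (intro mult_strict_left_mono powr_less_mono2) auto
    moreover have "\<beta> * \<beta> powr (r - 1) < \<beta> * (\<alpha> + \<beta>) powr (r - 1)"
      using that assms by (intro mult_strict_left_mono powr_less_mono2) auto
    ultimately have "\<alpha> * \<alpha> powr (r - 1) + \<beta> * \<beta> powr (r - 1) < (\<alpha> + \<beta>) * (\<alpha> + \<beta>) powr (r - 1)"
      unfolding distrib_right by (rule add_strict_mono)
    then show ?thesis using that by (simp only: e add_pos_pos)
  qed
  show "\<alpha> powr r + \<beta> powr r \<le> (\<alpha> + \<beta>) powr r"
  proof (cases "\<alpha> > 0 \<and> \<beta> > 0")
    case False
    then have "\<alpha> = 0 \<or> \<beta> = 0" using assms by auto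
    then show ?thesis by auto
  qed (use * in auto)
qed

text \<open>The variables stand for squared norms: \<open>X\<close> and \<open>Y\<close> of the sum
  and the difference, \<alpha> and \<beta> of the two vectors. Thus \<open>eq\<close> is the
  parallelogram law and \<open>r\<close> is \<open>p / 2\<close>. Midpoint convexity is combined
  with superadditivity, which is strict for positive arguments.\<close>

lemma Clarkson_powr_convex:
  fixes X Y \<alpha> \<beta> r :: real
  assumes "0 \<le> X" "0 \<le> Y" "0 \<le> \<alpha>" "0 \<le> \<beta>" and eq: "X + Y = 2 * (\<alpha> + \<beta>)" and r: "1 < r"
  shows "2 * (\<alpha> powr r + \<beta> powr r) \<le> X powr r + Y powr r"
    and "\<alpha> > 0 \<Longrightarrow> \<beta> > 0 \<Longrightarrow> 2 * (\<alpha> powr r + \<beta> powr r) < X powr r + Y powr r"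
proof -
  have "(1 / 2 * X + (1 - 1 / 2) * Y) powr r \<le> 1 / 2 * X powr r + (1 - 1 / 2) * Y powr r"
    using assms by (intro powr_convex_combination) auto
  moreover have "1 / 2 * X + (1 - 1 / 2) * Y = \<alpha> + \<beta>" using eq by simp
  ultimately have *: "2 * (\<alpha> + \<beta>) powr r \<le> X powr r + Y powr r" by simp
  show "2 * (\<alpha> powr r + \<beta> powr r) \<le> X powr r + Y powr r"
    by (rule order.trans[OF mult_left_mono[OF powr_superadditive(1)[OF r assms(3,4)]] *]) simp
  show "2 * (\<alpha> powr r + \<beta> powr r) < X powr r + Y powr r" if "\<alpha> > 0" "\<beta> > 0"
    by (rule order.strict_trans2[OF mult_strict_left_mono[OF powr_superadditive(2)[OF r assms(3,4) that]] *]) simp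
qed

text \<open>Convexity and superadditivity for the exponent \<open>1 / r > 1\<close> are applied to
  the \<open>r\<close>-th powers of the variables, and then the \<open>r\<close>-th power is
  taken.\<close>

lemma Clarkson_powr_concave:
  fixes X Y \<alpha> \<beta> r :: real
  assumes "0 \<le> X" "0 \<le> Y" "0 \<le> \<alpha>" "0 \<le> \<beta>" and eq: "X + Y = 2 * (\<alpha> + \<beta>)" and r: "0 < r" "r < 1"
  shows "X powr r + Y powr r \<le> 2 * (\<alpha> powr r + \<beta> powr r)"
    and "\<alpha> > 0 \<Longrightarrow> \<beta> > 0 \<Longrightarrow> X powr r + Y powr r < 2 * (\<alpha> powr r + \<beta> powr r)"
proof -
  have s: "1 < 1 / r" using r by simp
  have inv: "(x powr r) powr (1 / r) = x" "(x powr (1 / r)) powr r = x" if "x \<ge> 0" for x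
    using that r by (simp_all add: powr_powr)
  have "(1 / 2 * X powr r + (1 - 1 / 2) * Y powr r) powr (1 / r) \<le> 1 / 2 * (X powr r) powr (1 / r) + (1 - 1 / 2) * (Y powr r) powr (1 / r)"
    using s by (intro powr_convex_combination) auto
  also have "\<dots> = \<alpha> + \<beta>" using eq assms by (simp add: inv)
  finally have "((1 / 2 * X powr r + (1 - 1 / 2) * Y powr r) powr (1 / r)) powr r \<le> (\<alpha> + \<beta>) powr r"
    using r by (intro powr_mono2) auto
  then have *: "X powr r + Y powr r \<le> 2 * (\<alpha> + \<beta>) powr r" by (subst (asm) inv(2)) auto
  have ab: "(\<alpha> powr r) powr (1 / r) + (\<beta> powr r) powr (1 / r) = \<alpha> + \<beta>" using assms by (simp add: inv)
  have "(\<alpha> + \<beta>) powr r \<le> ((\<alpha> powr r + \<beta> powr r) powr (1 / r)) powr r"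
    using powr_superadditive(1)[OF s, of "\<alpha> powr r" "\<beta> powr r"] r assms unfolding ab
    by (intro powr_mono2) auto
  then have "(\<alpha> + \<beta>) powr r \<le> \<alpha> powr r + \<beta> powr r" by (subst (asm) inv(2)) auto
  then show "X powr r + Y powr r \<le> 2 * (\<alpha> powr r + \<beta> powr r)"
    by (intro order.trans[OF * mult_left_mono]) simp_all
  assume "\<alpha> > 0" "\<beta> > 0"
  then have "(\<alpha> + \<beta>) powr r < ((\<alpha> powr r + \<beta> powr r) powr (1 / r)) powr r"
    using powr_superadditive(2)[OF s, of "\<alpha> powr r" "\<beta> powr r"] r assms unfolding ab
    by (intro powr_less_mono2) auto
  then have "(\<alpha> + \<beta>) powr r < \<alpha> powr r + \<beta> powr r" by (subst (asm) inv(2)) auto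
  then show "X powr r + Y powr r < 2 * (\<alpha> powr r + \<beta> powr r)"
    by (intro order.strict_trans1[OF * mult_strict_left_mono]) simp_all
qed

lemma vnorm_add_power2:
  fixes v w :: "nat \<Rightarrow> 'k::real_inner"
  shows "(vnorm n (\<lambda>i. v i + w i))\<^sup>2 = (vnorm n v)\<^sup>2 + (vnorm n w)\<^sup>2 + 2 * (\<Sum>i<n. v i \<bullet> w i)"
    and "(vnorm n (\<lambda>i. v i - w i))\<^sup>2 = (vnorm n v)\<^sup>2 + (vnorm n w)\<^sup>2 - 2 * (\<Sum>i<n. v i \<bullet> w i)"
  unfolding vnorm_power2
  by (simp_all add: power2_norm_eq_inner inner_add inner_diff inner_commute sum.distrib sum_subtractf
      sum_distrib_left algebra_simps)

text \<open>The sign makes this nonnegative both for \<open>p > 2\<close> and for \<open>p < 2\<close>.\<close>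

definition Clarkson_defect :: "real \<Rightarrow> nat \<Rightarrow> (nat \<Rightarrow> 'k::real_inner) \<Rightarrow> (nat \<Rightarrow> 'k) \<Rightarrow> real"
  where "Clarkson_defect p n v w = sgn (p - 2) * (vnorm n (\<lambda>i. v i + w i) powr p + vnorm n (\<lambda>i. v i - w i) powr p
    - 2 * (vnorm n v powr p + vnorm n w powr p))"

text \<open>By the parallelogram law the squared norms fall under the convex case if
  \<open>p > 2\<close> and under the concave case if \<open>p < 2\<close>. The strict inequalities
  settle when the defect is zero.\<close>

lemma Clarkson_defect:
  assumes p: "1 \<le> p" "p \<noteq> 2"
  shows "0 \<le> Clarkson_defect p n v w"
    and "Clarkson_defect p n v w = 0 \<longleftrightarrow> vnorm n v = 0 \<or> vnorm n w = 0"
proof -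
  have sq: "x powr p = (x\<^sup>2) powr (p / 2)" if "x \<ge> 0" for x :: real
  proof -
    have "x\<^sup>2 = x powr 2" using that by (simp add: powr_numeral)
    then show ?thesis by (simp add: powr_powr)
  qed
  let ?X = "(vnorm n (\<lambda>i. v i + w i))\<^sup>2" and ?Y = "(vnorm n (\<lambda>i. v i - w i))\<^sup>2"
  let ?\<alpha> = "(vnorm n v)\<^sup>2" and ?\<beta> = "(vnorm n w)\<^sup>2"
  have eq: "?X + ?Y = 2 * (?\<alpha> + ?\<beta>)" unfolding vnorm_add_power2 by simp
  have D: "Clarkson_defect p n v w = sgn (p - 2) * (?X powr (p / 2) + ?Y powr (p / 2) - 2 * (?\<alpha> powr (p / 2) + ?\<beta> powr (p / 2)))"
    unfolding Clarkson_defect_def by (simp only: sq[OF vnorm_nonneg])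
  have "0 \<le> Clarkson_defect p n v w \<and> (vnorm n v \<noteq> 0 \<longrightarrow> vnorm n w \<noteq> 0 \<longrightarrow> 0 < Clarkson_defect p n v w)"
  proof (cases "p > 2")
    case True
    then have "1 < p / 2" by simp
    from Clarkson_powr_convex[OF _ _ _ _ eq this] show ?thesis using True unfolding D by simp
  next
    case False
    then have "0 < p / 2" "p / 2 < 1" using p by auto
    from Clarkson_powr_concave[OF _ _ _ _ eq this] show ?thesis using False p unfolding D by simp
  qed
  moreover have "Clarkson_defect p n v w = 0" if "vnorm n v = 0 \<or> vnorm n w = 0"
  proof -
    have "vnorm n (\<lambda>i. v i + w i) = vnorm n w" "vnorm n (\<lambda>i. v i - w i) = vnorm n w" if "vnorm n v = 0"
      using that unfolding vnorm_eq_0_iff by (auto simp: vnorm_def intro!: L2_set_cong)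
    moreover have "vnorm n (\<lambda>i. v i + w i) = vnorm n v" "vnorm n (\<lambda>i. v i - w i) = vnorm n v" if "vnorm n w = 0"
      using that unfolding vnorm_eq_0_iff by (auto simp: vnorm_def intro!: L2_set_cong)
    ultimately show ?thesis using that p by (auto simp: Clarkson_defect_def)
  qed
  ultimately show "0 \<le> Clarkson_defect p n v w"
    and "Clarkson_defect p n v w = 0 \<longleftrightarrow> vnorm n v = 0 \<or> vnorm n w = 0" by fastforce+
qed

text \<open>Up to sign the two sides differ by the integral of the pointwise Clarkson defects. As
  these are nonnegative, the integral vanishes iff the defect does almost everywhere. The left side
  involves the norm and the linear structure only, hence is invariant under isometries.\<close>

lemma disjoint_iff_mixed_mod:
  fixes x y :: "'k::{real_normed_field,euclidean_space} L0"
  assumes n: "n > 0" and p: "1 \<le> p" "p \<noteq> 2" and x: "x \<in> Lp p" and y: "y \<in> Lp p"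
  shows "mixed_mod p n (x + y) + mixed_mod p n (x - y) = 2 * (mixed_mod p n x + mixed_mod p n y) \<longleftrightarrow>
    (AE t in \<lambda>\<^sub>0\<^sub>1. fibre_norm n x t = 0 \<or> fibre_norm n y t = 0)"
proof -
  have i: "integrable \<lambda>\<^sub>0\<^sub>1 (\<lambda>t. fibre_norm n z t powr p)" if "z \<in> Lp p" for z :: "'k L0"
    using that by (simp only: Lp_iff_fibre_norm[OF n p(1)])
  have xy: "x + y \<in> Lp p" "x - y \<in> Lp p"
    using Lp_add_mixed_norm(1)[OF n p(1) x y] Lp_diff[OF p(1) x y] .
  let ?D = "\<lambda>t. sgn (p - 2) * (fibre_norm n (x + y) t powr p + fibre_norm n (x - y) t powr p
      - 2 * (fibre_norm n x t powr p + fibre_norm n y t powr p))"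
  have iD: "integrable \<lambda>\<^sub>0\<^sub>1 ?D" using i[OF x] i[OF y] i[OF xy(1)] i[OF xy(2)] by auto
  have "AE t in \<lambda>\<^sub>0\<^sub>1. fibre_norm n (x + y) t = vnorm n (\<lambda>i. coord n x i t + coord n y i t)"
    by (rule fibre_norm_cong_AE[OF coord_add])
  moreover have "AE t in \<lambda>\<^sub>0\<^sub>1. fibre_norm n (x - y) t = vnorm n (\<lambda>i. coord n x i t - coord n y i t)"
    by (rule fibre_norm_cong_AE[OF coord_diff])
  ultimately have D: "AE t in \<lambda>\<^sub>0\<^sub>1. ?D t = Clarkson_defect p n (\<lambda>i. coord n x i t) (\<lambda>i. coord n y i t)"
    by eventually_elim (simp add: Clarkson_defect_def fibre_norm_def)
  have "mixed_mod p n (x + y) + mixed_mod p n (x - y) = 2 * (mixed_mod p n x + mixed_mod p n y) \<longleftrightarrow> (LINT t|\<lambda>\<^sub>0\<^sub>1. ?D t) = 0"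
    using i[OF x] i[OF y] i[OF xy(1)] i[OF xy(2)] p by (simp add: mixed_mod_def sgn_if)
  also have "\<dots> \<longleftrightarrow> (AE t in \<lambda>\<^sub>0\<^sub>1. ?D t = 0)"
  proof (rule integral_nonneg_eq_0_iff_AE[OF iD])
    show "AE t in \<lambda>\<^sub>0\<^sub>1. 0 \<le> ?D t" using D by eventually_elim (simp only: Clarkson_defect(1)[OF p])
  qed
  also have "\<dots> \<longleftrightarrow> (AE t in \<lambda>\<^sub>0\<^sub>1. fibre_norm n x t = 0 \<or> fibre_norm n y t = 0)"
  proof -
    have "AE t in \<lambda>\<^sub>0\<^sub>1. ?D t = 0 \<longleftrightarrow> fibre_norm n x t = 0 \<or> fibre_norm n y t = 0"
      using D by eventually_elim (simp only: Clarkson_defect(2)[OF p] fibre_norm_def)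
    then show ?thesis by (rule eventually_subst)
  qed
  finally show ?thesis .
qed

text \<open>The set \<open>B\<close> consists of parameters \<open>t\<close>, so the cut acts on all
  \<open>n\<close> pieces simultaneously: it multiplies the \<open>K^n\<close>-valued function by an
  indicator.\<close>

definition cut_L0 :: "nat \<Rightarrow> real set \<Rightarrow> 'k L0 \<Rightarrow> 'k::{real_normed_field,second_countable_topology} L0"
  where "cut_L0 n B x = glue_L0 n (\<lambda>i t. indicator B t *\<^sub>R coord n x i t)"

lemma coord_cut_L0:
  assumes B: "B \<in> sets lebesgue" and i: "i < n"
  shows "AE t in \<lambda>\<^sub>0\<^sub>1. coord n (cut_L0 n B x) i t = indicator B t *\<^sub>R coord n x i t"
proof -
  have [measurable]: "(indicator B :: real \<Rightarrow> real) \<in> borel_measurable \<lambda>\<^sub>0\<^sub>1"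
    using B by (intro measurable_restrict_space1 borel_measurable_indicator)
  have "(\<lambda>t. indicator B t *\<^sub>R coord n x i t) \<in> borel_measurable \<lambda>\<^sub>0\<^sub>1" if "i < n" for i
    using coord_measurable[OF that, of x] by measurable
  then show ?thesis unfolding cut_L0_def by (intro coord_glue_L0 i)
qed

lemma fibre_norm_cut_L0:
  assumes B: "B \<in> sets lebesgue"
  shows "AE t in \<lambda>\<^sub>0\<^sub>1. fibre_norm n (cut_L0 n B x) t = indicator B t * fibre_norm n x t"
proof -
  have "AE t in \<lambda>\<^sub>0\<^sub>1. fibre_norm n (cut_L0 n B x) t = vnorm n (\<lambda>i. indicator B t *\<^sub>R coord n x i t)"
    by (rule fibre_norm_cong_AE) (rule coord_cut_L0[OF B])
  then show ?thesis by eventually_elim (simp add: fibre_norm_def vnorm_scaleR)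
qed

lemma cut_L0_Lp:
  assumes n: "n > 0" and p: "1 \<le> p" and B: "B \<in> sets lebesgue" and x: "x \<in> Lp p"
  shows "cut_L0 n B x \<in> Lp p"
    and "mixed_mod p n (cut_L0 n B x) = (LINT t|\<lambda>\<^sub>0\<^sub>1. indicator B t * fibre_norm n x t powr p)"
proof -
  have i: "integrable \<lambda>\<^sub>0\<^sub>1 (\<lambda>t. fibre_norm n x t powr p)" using x by (simp only: Lp_iff_fibre_norm[OF n p])
  have Bm [measurable]: "(indicator B :: real \<Rightarrow> real) \<in> borel_measurable \<lambda>\<^sub>0\<^sub>1"
    using B by (intro measurable_restrict_space1 borel_measurable_indicator)
  have eq: "AE t in \<lambda>\<^sub>0\<^sub>1. fibre_norm n (cut_L0 n B x) t powr p = indicator B t * fibre_norm n x t powr p"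
    using fibre_norm_cut_L0[OF B, of n x] by eventually_elim (simp add: indicator_def)
  have "integrable \<lambda>\<^sub>0\<^sub>1 (\<lambda>t. fibre_norm n (cut_L0 n B x) t powr p)"
    using eq by (intro Bochner_Integration.integrable_bound[OF i]) (auto simp: indicator_def elim: eventually_mono)
  then show "cut_L0 n B x \<in> Lp p" by (simp only: Lp_iff_fibre_norm[OF n p])
  show "mixed_mod p n (cut_L0 n B x) = (LINT t|\<lambda>\<^sub>0\<^sub>1. indicator B t * fibre_norm n x t powr p)"
    unfolding mixed_mod_def by (intro integral_cong_AE eq) measurable
qed

lemma cut_L0_add_compl:
  assumes n: "n > 0" and B: "B \<in> sets lebesgue"
  shows "cut_L0 n B x + cut_L0 n (- B) x = x"
proof (subst L0_eq_iff_coord[OF n], intro allI impI)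
  fix i assume i: "i < n"
  have B': "- B \<in> sets lebesgue" using B by (rule Compl_in_sets_lebesgue[THEN iffD2])
  show "AE t in \<lambda>\<^sub>0\<^sub>1. coord n (cut_L0 n B x + cut_L0 n (- B) x) i t = coord n x i t"
    using coord_add[OF i, of "cut_L0 n B x" "cut_L0 n (- B) x"] coord_cut_L0[OF B i, of x] coord_cut_L0[OF B' i, of x]
    by eventually_elim (simp add: indicator_def)
qed

text \<open>The hypothesis is tested on the set where \<open>h < g\<close>; the difference is
  positive there, so this set must be null.\<close>

lemma AE_le_if_set_integral_le:
  fixes g h :: "real \<Rightarrow> real"
  assumes g: "integrable \<lambda>\<^sub>0\<^sub>1 g" and h: "integrable \<lambda>\<^sub>0\<^sub>1 h"
    and le: "\<And>B. B \<in> sets lebesgue \<Longrightarrow> (LINT t|\<lambda>\<^sub>0\<^sub>1. indicator B t * g t) \<le> (LINT t|\<lambda>\<^sub>0\<^sub>1. indicator B t * h t)"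
  shows "AE t in \<lambda>\<^sub>0\<^sub>1. g t \<le> h t"
proof -
  have [measurable]: "g \<in> borel_measurable \<lambda>\<^sub>0\<^sub>1" "h \<in> borel_measurable \<lambda>\<^sub>0\<^sub>1" using g h by auto
  let ?B = "{t \<in> space \<lambda>\<^sub>0\<^sub>1. h t < g t}"
  have B1: "?B \<in> sets \<lambda>\<^sub>0\<^sub>1" by measurable
  then have B: "?B \<in> sets lebesgue" by (subst (asm) sets_restrict_space_iff) auto
  have i: "integrable \<lambda>\<^sub>0\<^sub>1 (\<lambda>t. indicator ?B t * g t)" "integrable \<lambda>\<^sub>0\<^sub>1 (\<lambda>t. indicator ?B t * h t)"
    using integrable_mult_indicator[OF B1 g] integrable_mult_indicator[OF B1 h] by (simp_all only: real_scaleR_def)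
  let ?d = "\<lambda>t. indicator ?B t * g t - indicator ?B t * h t"
  have nn: "AE t in \<lambda>\<^sub>0\<^sub>1. 0 \<le> ?d t" by (rule AE_I2) (auto simp: indicator_def)
  have id: "integrable \<lambda>\<^sub>0\<^sub>1 ?d" using i by (rule Bochner_Integration.integrable_diff)
  have "(LINT t|\<lambda>\<^sub>0\<^sub>1. ?d t) \<le> 0"
    using le[OF B] by (subst Bochner_Integration.integral_diff[OF i]) simp
  moreover have "0 \<le> (LINT t|\<lambda>\<^sub>0\<^sub>1. ?d t)" using nn by (rule integral_nonneg_AE)
  ultimately have "(LINT t|\<lambda>\<^sub>0\<^sub>1. ?d t) = 0" by simp
  then have "AE t in \<lambda>\<^sub>0\<^sub>1. ?d t = 0" using integral_nonneg_eq_0_iff_AE[OF id nn] by blast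
  then show ?thesis using AE_space by eventually_elim (auto simp: indicator_def split: if_splits)
qed

text \<open>Bessel's inequality for each unit vector, summed over all of \<open>J\<close>, compares
  \<open>m * R\<close> with \<open>card J * R\<close>.\<close>

lemma orthogonal_family_bound:
  fixes f :: "nat \<Rightarrow> 'j \<Rightarrow> real"
  assumes J: "finite J" and R: "R > 0"
    and orth: "\<And>i l. i < m \<Longrightarrow> l < m \<Longrightarrow> (\<Sum>j\<in>J. f i j * f l j) = (if i = l then R else 0)"
  shows "m \<le> card J"
proof -
  have Bessel: "(\<Sum>i<m. (f i k)\<^sup>2) \<le> R" if k: "k \<in> J" for k
  proof -
    \<comment> \<open>Here \<open>?\<delta>\<close> is \<open>R\<close> times the
      \<open>k\<close>-th unit vector and \<open>?s\<close> is its orthogonal projection onto the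
      span of the family.\<close>
    let ?s = "\<lambda>j. \<Sum>i<m. f i k * f i j"
    let ?\<delta> = "\<lambda>j. (if j = k then R else 0) :: real"
    have "(\<Sum>j\<in>J. (?s j)\<^sup>2) = (\<Sum>j\<in>J. \<Sum>i<m. \<Sum>l<m. (f i k * f l k) * (f i j * f l j))"
      by (simp add: power2_eq_square sum_product algebra_simps)
    also have "\<dots> = (\<Sum>i<m. \<Sum>l<m. (f i k * f l k) * (\<Sum>j\<in>J. f i j * f l j))"
      by (subst sum.swap, intro sum.cong refl, subst sum.swap) (simp add: sum_distrib_left)
    also have "\<dots> = (\<Sum>i<m. \<Sum>l<m. if l = i then (f i k)\<^sup>2 * R else 0)"
      by (intro sum.cong refl) (auto simp: orth power2_eq_square)
    also have "\<dots> = R * (\<Sum>i<m. (f i k)\<^sup>2)"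
      by (simp add: sum.delta sum_distrib_left mult.commute)
    finally have s2: "(\<Sum>j\<in>J. (?s j)\<^sup>2) = R * ?s k" by (simp add: power2_eq_square)
    have "0 \<le> (\<Sum>j\<in>J. (?\<delta> j - ?s j)\<^sup>2)" by (intro sum_nonneg) auto
    also have "\<dots> = (\<Sum>j\<in>J. (?\<delta> j)\<^sup>2) - 2 * (\<Sum>j\<in>J. ?\<delta> j * ?s j) + (\<Sum>j\<in>J. (?s j)\<^sup>2)"
      by (simp add: power2_diff sum.distrib sum_subtractf sum_distrib_left mult.assoc)
    also have "(\<Sum>j\<in>J. (?\<delta> j)\<^sup>2) = R\<^sup>2"
      using J k by (simp add: if_distrib[of "\<lambda>x. x\<^sup>2"] sum.delta cong: if_cong)
    also have "(\<Sum>j\<in>J. ?\<delta> j * ?s j) = R * ?s k"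
      using J k by (simp add: if_distrib[of "\<lambda>x. x * _"] sum.delta cong: if_cong)
    finally have "R * ?s k \<le> R * R" using s2 by (simp add: power2_eq_square)
    then show ?thesis using R by (simp add: power2_eq_square)
  qed
  have "real m * R = (\<Sum>i<m. \<Sum>j\<in>J. (f i j)\<^sup>2)"
    using orth by (simp add: power2_eq_square)
  also have "\<dots> = (\<Sum>j\<in>J. \<Sum>i<m. (f i j)\<^sup>2)" by (rule sum.swap)
  also have "\<dots> \<le> (\<Sum>j\<in>J. R)" by (intro sum_mono Bessel)
  finally show ?thesis using R by simp
qed

section \<open>Rigidity of isometries\<close>

lemma mixed_mod_eq_powr: "1 \<le> p \<Longrightarrow> mixed_mod p n x = mixed_norm p n x powr p"
  by (simp add: mixed_norm_def powr_powr)

text \<open>Says that the fibre norm of the preimage of a constant \<open>c\<close> is proportional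
  to the length of \<open>c\<close>, with a factor depending on \<open>t\<close> alone. The
  cross-multiplied form admits zero vectors.\<close>

lemma fibre_norm_const_preimage:
  fixes S T :: "'k::{real_normed_field,euclidean_space} L0 \<Rightarrow> 'k L0"
  assumes a: "a > 0" and b: "b > 0" and p: "1 \<le> p" "p \<noteq> 2"
    and T: "linear_on (Lp p) T" "\<And>x. x \<in> Lp p \<Longrightarrow> T x \<in> Lp p"
    and iso: "\<And>x. x \<in> Lp p \<Longrightarrow> mixed_norm p b (T x) = mixed_norm p a x"
    and S: "\<And>x. x \<in> Lp p \<Longrightarrow> S x \<in> Lp p" "\<And>x. x \<in> Lp p \<Longrightarrow> T (S x) = x"
  shows "AE t in \<lambda>\<^sub>0\<^sub>1. vnorm b d * fibre_norm a (S (const_L0 b c)) t = vnorm b c * fibre_norm a (S (const_L0 b d)) t"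
proof -
  let ?f = "\<lambda>c. S (const_L0 b c)"
  have fL: "?f c \<in> Lp p" for c by (intro S const_L0_Lp b p)
  have modT: "mixed_mod p b (T x) = mixed_mod p a x" if "x \<in> Lp p" for x
    using iso[OF that] by (simp add: mixed_mod_eq_powr p)
  have cutL: "cut_L0 a B (?f c) \<in> Lp p" if "B \<in> sets lebesgue" for B c
    using cut_L0_Lp(1)[OF a p(1) that fL] .
  have compl: "- B \<in> sets lebesgue" if "B \<in> sets lebesgue" for B :: "real set"
    using that by (rule Compl_in_sets_lebesgue[THEN iffD2])
  \<comment> \<open>Restrictions to \<open>B\<close> and to its complement are disjoint even if they
    come from different preimages, and \<open>T\<close> preserves this by the norm
    criterion.\<close>
  have disj: "AE t in \<lambda>\<^sub>0\<^sub>1. fibre_norm b (T (cut_L0 a B (?f c))) t = 0 \<or> fibre_norm b (T (cut_L0 a (- B) (?f d))) t = 0"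
    if B: "B \<in> sets lebesgue" for B c d
  proof -
    let ?x = "cut_L0 a B (?f c)" and ?y = "cut_L0 a (- B) (?f d)"
    note xy = cutL[OF B, of c] cutL[OF compl[OF B], of d]
    have "AE t in \<lambda>\<^sub>0\<^sub>1. fibre_norm a ?x t = 0 \<or> fibre_norm a ?y t = 0"
      using fibre_norm_cut_L0[OF B, of a "?f c"] fibre_norm_cut_L0[OF compl[OF B], of a "?f d"]
      by eventually_elim (simp add: indicator_def)
    then have "mixed_mod p a (?x + ?y) + mixed_mod p a (?x - ?y) = 2 * (mixed_mod p a ?x + mixed_mod p a ?y)"
      using disjoint_iff_mixed_mod[OF a p xy] by blast
    moreover have "T (?x + ?y) = T ?x + T ?y" "T (?x - ?y) = T ?x - T ?y"
      using T(1) xy linear_on_diff[OF T(1) xy Lp_scale[OF p(1)]] by (auto simp: linear_on_def)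
    ultimately have "mixed_mod p b (T ?x + T ?y) + mixed_mod p b (T ?x - T ?y) = 2 * (mixed_mod p b (T ?x) + mixed_mod p b (T ?y))"
      using modT[OF xy(1)] modT[OF xy(2)] modT[OF Lp_diff[OF p(1) xy]] modT[OF Lp_add_mixed_norm(1)[OF a p(1) xy]]
      by simp
    then show ?thesis using disjoint_iff_mixed_mod[OF b p T(2)[OF xy(1)] T(2)[OF xy(2)]] by blast
  qed
  \<comment> \<open>The images of the two restrictions are disjoint and add up to the constant
    \<open>c\<close>, so at almost every point one of them is all of \<open>c\<close>.\<close>
  have dich: "AE t in \<lambda>\<^sub>0\<^sub>1. fibre_norm b (T (cut_L0 a B (?f c))) t = 0 \<and> fibre_norm b (T (cut_L0 a (- B) (?f c))) t = vnorm b c \<or>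
      fibre_norm b (T (cut_L0 a B (?f c))) t = vnorm b c \<and> fibre_norm b (T (cut_L0 a (- B) (?f c))) t = 0"
    if B: "B \<in> sets lebesgue" for B c
  proof -
    let ?x = "cut_L0 a B (?f c)" and ?y = "cut_L0 a (- B) (?f c)"
    have "T ?x + T ?y = T (?x + ?y)" using T(1) cutL B compl[OF B] by (simp add: linear_on_def)
    also have "\<dots> = const_L0 b c" using S(2)[OF const_L0_Lp[OF b p(1)]] by (simp add: cut_L0_add_compl[OF a B])
    finally have sum: "T ?x + T ?y = const_L0 b c" .
    have "AE t in \<lambda>\<^sub>0\<^sub>1. \<forall>i<b. coord b (T ?x) i t + coord b (T ?y) i t = c i"
      unfolding AE_all_less
    proof (intro allI impI)
      fix i assume i: "i < b"
      show "AE t in \<lambda>\<^sub>0\<^sub>1. coord b (T ?x) i t + coord b (T ?y) i t = c i"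
        using coord_add[OF i, of "T ?x" "T ?y"] coord_const_L0[OF i, of c] unfolding sum
        by eventually_elim simp
    qed
    with disj[OF B, of c c] show ?thesis
    proof eventually_elim
      case (elim t)
      then show ?case
        unfolding fibre_norm_def vnorm_eq_0_iff by (auto intro!: vnorm_cong)
    qed
  qed
  have int_eq: "(LINT t|\<lambda>\<^sub>0\<^sub>1. indicator B t * (vnorm b d powr p * fibre_norm a (?f c) t powr p)) =
      (LINT t|\<lambda>\<^sub>0\<^sub>1. indicator B t * (vnorm b c powr p * fibre_norm a (?f d) t powr p))"
    if B: "B \<in> sets lebesgue" for B c d
  proof -
    let ?xc = "cut_L0 a B (?f c)" and ?xd = "cut_L0 a B (?f d)"
    \<comment> \<open>Where the image of the cut of \<open>?f c\<close> is nonzero, the image of the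
      complementary cut of \<open>?f d\<close> vanishes, so the cut of \<open>?f d\<close> is mapped
      to the full value \<open>d\<close> there.\<close>
    have eq: "AE t in \<lambda>\<^sub>0\<^sub>1. vnorm b d * fibre_norm b (T ?xc) t = vnorm b c * fibre_norm b (T ?xd) t"
      using disj[OF B, of c d] disj[OF B, of d c] dich[OF B, of c] dich[OF B, of d]
      by eventually_elim auto
    have "AE t in \<lambda>\<^sub>0\<^sub>1. vnorm b d powr p * fibre_norm b (T ?xc) t powr p = vnorm b c powr p * fibre_norm b (T ?xd) t powr p"
      using eq
    proof eventually_elim
      case (elim t)
      then have "(vnorm b d * fibre_norm b (T ?xc) t) powr p = (vnorm b c * fibre_norm b (T ?xd) t) powr p" by simp
      then show ?case by (simp add: powr_mult)
    qed
    then have "(LINT t|\<lambda>\<^sub>0\<^sub>1. vnorm b d powr p * fibre_norm b (T ?xc) t powr p) = (LINT t|\<lambda>\<^sub>0\<^sub>1. vnorm b c powr p * fibre_norm b (T ?xd) t powr p)"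
      by (intro integral_cong_AE) auto
    then have "vnorm b d powr p * mixed_mod p b (T ?xc) = vnorm b c powr p * mixed_mod p b (T ?xd)"
      by (simp add: mixed_mod_def)
    then have "vnorm b d powr p * mixed_mod p a ?xc = vnorm b c powr p * mixed_mod p a ?xd"
      by (simp only: modT cutL[OF B])
    then show ?thesis
      by (simp add: cut_L0_Lp(2)[OF a p(1) B fL] mult.left_commute[of "indicator B _"])
  qed
  have fi: "integrable \<lambda>\<^sub>0\<^sub>1 (\<lambda>t. vnorm b d powr p * fibre_norm a (?f c) t powr p)" for c d
    using fL[of c] unfolding Lp_iff_fibre_norm[OF a p(1)] by simp
  \<comment> \<open>The integrals agree over every measurable set. The resulting inequality for all
    \<open>c\<close> and \<open>d\<close> is used twice, with the vectors exchanged.\<close>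
  have "AE t in \<lambda>\<^sub>0\<^sub>1. vnorm b d powr p * fibre_norm a (?f c) t powr p \<le> vnorm b c powr p * fibre_norm a (?f d) t powr p" for c d
    using int_eq by (intro AE_le_if_set_integral_le fi) (simp add: order.refl)
  from this[of d c] this[of c d]
  show ?thesis
  proof eventually_elim
    case (elim t)
    then have "(vnorm b d * fibre_norm a (?f c) t) powr p = (vnorm b c * fibre_norm a (?f d) t) powr p"
      by (simp add: powr_mult)
    then have "((vnorm b d * fibre_norm a (?f c) t) powr p) powr (1 / p) = ((vnorm b c * fibre_norm a (?f d) t) powr p) powr (1 / p)"
      by simp
    then show ?case using p by (simp add: powr_powr)
  qed
qed

lemma const_L0_add:
  assumes n: "n > 0"
  shows "const_L0 n (\<lambda>i. c i + d i) = const_L0 n c + const_L0 n d"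
proof (subst L0_eq_iff_coord[OF n], intro allI impI)
  fix i assume i: "i < n"
  show "AE t in \<lambda>\<^sub>0\<^sub>1. coord n (const_L0 n (\<lambda>i. c i + d i)) i t = coord n (const_L0 n c + const_L0 n d) i t"
    using coord_const_L0[OF i, of "\<lambda>i. c i + d i"] coord_const_L0[OF i, of c] coord_const_L0[OF i, of d]
      coord_add[OF i, of "const_L0 n c" "const_L0 n d"] by eventually_elim simp
qed

text \<open>Everything is evaluated at a single point \<open>t\<close>, where the preimages of the
  unit vectors become \<open>b\<close> real-orthogonal vectors of equal nonzero length in
  \<open>K^a\<close>. The factor \<open>DIM('k)\<close> is there because orthogonality holds for the
  real inner product and \<open>K^a\<close> has real dimension \<open>a * DIM('k)\<close>.\<close>

lemma isometry_dimension_bound: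
  fixes T :: "'k::{real_normed_field,euclidean_space} L0 \<Rightarrow> 'k L0"
  assumes a: "a > 0" and b: "b > 0" and p: "1 \<le> p" "p \<noteq> 2"
    and T: "linear_on (Lp p) T" "bij_betw T (Lp p) (Lp p)"
    and iso: "\<And>x. x \<in> Lp p \<Longrightarrow> mixed_norm p a x = mixed_norm p b (T x)"
  shows "b \<le> a * DIM('k)"
proof -
  define S where "S = inv_into (Lp p) T"
  have S: "S x \<in> Lp p" "T (S x) = x" if "x \<in> Lp p" for x
    using that T(2) by (auto simp: S_def bij_betw_def inv_into_into f_inv_into_f)
  have Tin: "T x \<in> Lp p" if "x \<in> Lp p" for x using that T(2) by (auto simp: bij_betw_def)
  have Slin: "linear_on (Lp p) S"
    unfolding S_def using Lp_add_mixed_norm(1)[OF a p(1)] Lp_scale[OF p(1)] by (intro linear_on_inv_into T)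
  have rigid: "AE t in \<lambda>\<^sub>0\<^sub>1. vnorm b d * fibre_norm a (S (const_L0 b c)) t = vnorm b c * fibre_norm a (S (const_L0 b d)) t" for c d
    using Tin S by (intro fibre_norm_const_preimage[OF a b p T(1)]) (simp_all add: iso)
  let ?\<delta> = "\<lambda>i k. (if k = i then 1 else 0) :: 'k"
  let ?f = "\<lambda>i. S (const_L0 b (?\<delta> i))"
  have vd: "vnorm b (?\<delta> i) = 1" if "i < b" for i
  proof -
    have "(vnorm b (?\<delta> i))\<^sup>2 = 1"
      using that by (simp add: vnorm_power2 if_distrib[of "\<lambda>x. (norm x)\<^sup>2"] sum.delta cong: if_cong)
    then show ?thesis by (simp add: power2_eq_1_iff) (use vnorm_nonneg[of b "?\<delta> i"] in linarith)
  qed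
  \<comment> \<open>The sum of two distinct unit vectors has squared length 2; compared with the
    length of the sum of their preimages this yields orthogonality by polarisation.\<close>
  have vdd: "(vnorm b (\<lambda>k. ?\<delta> i k + ?\<delta> l k))\<^sup>2 = 2" if "i < b" "l < b" "i \<noteq> l" for i l
  proof -
    have "(\<Sum>k<b. ?\<delta> i k \<bullet> ?\<delta> l k) = 0" using that by (intro sum.neutral) auto
    then show ?thesis unfolding vnorm_add_power2 using that by (simp add: vd)
  qed
  have f_add: "S (const_L0 b (\<lambda>k. ?\<delta> i k + ?\<delta> l k)) = ?f i + ?f l" for i l
    unfolding const_L0_add[OF b] using Slin const_L0_Lp[OF b p(1)] unfolding linear_on_def by blast
  \<comment> \<open>Only finitely many pairs of indices occur, so all the relations hold together at
    almost every point.\<close>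
  let ?good = "\<lambda>t. \<forall>i<b. \<forall>l<b. fibre_norm a (?f i) t = fibre_norm a (?f 0) t \<and>
      (i \<noteq> l \<longrightarrow> (\<Sum>k<a. coord a (?f i) k t \<bullet> coord a (?f l) k t) = 0)"
  have good: "AE t in \<lambda>\<^sub>0\<^sub>1. ?good t"
    unfolding AE_all_less
  proof (intro allI impI)
    fix i l assume i: "i < b" and l: "l < b"
    have r0: "AE t in \<lambda>\<^sub>0\<^sub>1. fibre_norm a (?f i) t = fibre_norm a (?f 0) t" if "i < b" for i
      using rigid[of "?\<delta> 0" "?\<delta> i"] by eventually_elim (use that b in \<open>simp add: vd\<close>)
    have "AE t in \<lambda>\<^sub>0\<^sub>1. vnorm b (?\<delta> 0) * fibre_norm a (?f i + ?f l) t = vnorm b (\<lambda>k. ?\<delta> i k + ?\<delta> l k) * fibre_norm a (?f 0) t"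
      using rigid[of "?\<delta> 0" "\<lambda>k. ?\<delta> i k + ?\<delta> l k"] unfolding f_add .
    moreover have "AE t in \<lambda>\<^sub>0\<^sub>1. fibre_norm a (?f i + ?f l) t = vnorm a (\<lambda>k. coord a (?f i) k t + coord a (?f l) k t)"
      by (rule fibre_norm_cong_AE[OF coord_add])
    ultimately show "AE t in \<lambda>\<^sub>0\<^sub>1. fibre_norm a (?f i) t = fibre_norm a (?f 0) t \<and>
      (i \<noteq> l \<longrightarrow> (\<Sum>k<a. coord a (?f i) k t \<bullet> coord a (?f l) k t) = 0)"
      using r0[OF i] r0[OF l]
    proof eventually_elim
      case (elim t)
      have "(\<Sum>k<a. coord a (?f i) k t \<bullet> coord a (?f l) k t) = 0" if "i \<noteq> l"
      proof -
        have "fibre_norm a (?f i + ?f l) t = vnorm b (\<lambda>k. ?\<delta> i k + ?\<delta> l k) * fibre_norm a (?f 0) t"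
          using elim(1) b by (simp only: vd mult_1_left)
        then have "(fibre_norm a (?f i + ?f l) t)\<^sup>2 = 2 * (fibre_norm a (?f 0) t)\<^sup>2"
          by (simp only: power_mult_distrib vdd[OF i l that])
        moreover have "(fibre_norm a (?f i + ?f l) t)\<^sup>2 = (fibre_norm a (?f i) t)\<^sup>2 + (fibre_norm a (?f l) t)\<^sup>2
            + 2 * (\<Sum>k<a. coord a (?f i) k t \<bullet> coord a (?f l) k t)"
          unfolding elim(2) vnorm_add_power2 by (simp only: fibre_norm_def)
        ultimately show ?thesis unfolding elim(3,4) by simp
      qed
      then show ?case using elim(3) by blast
    qed
  qed
  \<comment> \<open>The preimage of a nonzero constant cannot be 0, since \<open>T\<close> maps 0 to
    0; this leaves a good point with nonzero fibre norm.\<close>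
  have nz: "\<not> (AE t in \<lambda>\<^sub>0\<^sub>1. fibre_norm a (?f 0) t = 0)"
  proof
    assume "AE t in \<lambda>\<^sub>0\<^sub>1. fibre_norm a (?f 0) t = 0"
    then have "?f 0 = 0" using L0_eq_0_iff_fibre_norm[OF a] by blast
    moreover have "T 0 = 0"
      using linear_on_diff[OF T(1) S(1) S(1) Lp_scale[OF p(1)], of "const_L0 b (?\<delta> 0)" "const_L0 b (?\<delta> 0)"]
        const_L0_Lp[OF b p(1), of "?\<delta> 0"] by simp
    ultimately have "const_L0 b (?\<delta> 0) = 0" using S(2)[OF const_L0_Lp[OF b p(1)], of "?\<delta> 0"] by simp
    then have "AE t in \<lambda>\<^sub>0\<^sub>1. fibre_norm b (const_L0 b (?\<delta> 0)) t = 0" using L0_eq_0_iff_fibre_norm[OF b] by blast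
    then have "AE t in \<lambda>\<^sub>0\<^sub>1. False"
      using fibre_norm_const_L0[of b "?\<delta> 0"] by eventually_elim (use b vd in simp)
    then show False
      by (simp add: AE_lebesgue_on_iff_null null_sets_def del: atLeastAtMost_iff)
  qed
  have "\<exists>t. fibre_norm a (?f 0) t \<noteq> 0 \<and> ?good t"
  proof (rule ccontr)
    assume none: "\<not> ?thesis"
    from good have "AE t in \<lambda>\<^sub>0\<^sub>1. fibre_norm a (?f 0) t = 0"
      by (rule eventually_mono) (use none in blast)
    with nz show False ..
  qed
  then obtain t where t0: "fibre_norm a (?f 0) t \<noteq> 0" and good_t: "?good t" by blast
  have t: "fibre_norm a (?f i) t = fibre_norm a (?f 0) t \<and>
      (i \<noteq> l \<longrightarrow> (\<Sum>k<a. coord a (?f i) k t \<bullet> coord a (?f l) k t) = 0)" if "i < b" "l < b" for i l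
    using good_t that by blast
  have "b \<le> card ({..<a} \<times> (Basis :: 'k set))"
  \<comment> \<open>Real coordinates of \<open>K^a\<close> are indexed by a component of the fibre
    together with a basis vector of the scalar field.\<close>
  proof (rule orthogonal_family_bound[where R = "(fibre_norm a (?f 0) t)\<^sup>2" and f = "\<lambda>i (k, e). coord a (?f i) k t \<bullet> e"])
    show "(\<Sum>j\<in>{..<a} \<times> Basis. (case j of (k, e) \<Rightarrow> coord a (?f i) k t \<bullet> e) * (case j of (k, e) \<Rightarrow> coord a (?f l) k t \<bullet> e)) =
      (if i = l then (fibre_norm a (?f 0) t)\<^sup>2 else 0)" if "i < b" "l < b" for i l
    proof -
      have "(\<Sum>j\<in>{..<a} \<times> Basis. (case j of (k, e) \<Rightarrow> coord a (?f i) k t \<bullet> e) * (case j of (k, e) \<Rightarrow> coord a (?f l) k t \<bullet> e)) =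
        (\<Sum>k<a. \<Sum>e\<in>Basis. (coord a (?f i) k t \<bullet> e) * (coord a (?f l) k t \<bullet> e))"
        by (subst sum.cartesian_product) (auto intro: sum.cong)
      also have "\<dots> = (\<Sum>k<a. coord a (?f i) k t \<bullet> coord a (?f l) k t)"
        by (simp only: euclidean_inner[symmetric])
      also have "\<dots> = (if i = l then (fibre_norm a (?f 0) t)\<^sup>2 else 0)"
      proof (cases "i = l")
        case True
        then have "(\<Sum>k<a. coord a (?f i) k t \<bullet> coord a (?f l) k t) = (fibre_norm a (?f i) t)\<^sup>2"
          by (simp only: fibre_norm_def vnorm_power2 power2_norm_eq_inner)
        then show ?thesis using t[OF that] True by simp
      qed (use t[OF that] in simp)
      finally show ?thesis .
    qed
  qed (use t0 in auto)
  then show ?thesis by (simp add: card_cartesian_product)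
qed

text \<open>The dimension bound applies to the conjugating map and to its inverse, so a gap in
  either direction is contradictory.\<close>

lemma mixed_norm_not_conjugate:
  assumes a: "a > 0" and b: "b > 0" and p: "1 \<le> p" "p \<noteq> 2"
    and ab: "a * DIM('k::{real_normed_field,euclidean_space}) < b \<or> b * DIM('k) < a"
  shows "\<not> conjugate_norms_on (Lp p) (Lp_norm p) (mixed_norm p a :: 'k L0 \<Rightarrow> real) (mixed_norm p b)"
proof
  assume "conjugate_norms_on (Lp p) (Lp_norm p) (mixed_norm p a :: 'k L0 \<Rightarrow> real) (mixed_norm p b)"
  then obtain T :: "'k L0 \<Rightarrow> 'k L0" where T: "linear_on (Lp p) T" "bij_betw T (Lp p) (Lp p)"
    and iso: "\<And>x. x \<in> Lp p \<Longrightarrow> mixed_norm p a x = mixed_norm p b (T x)"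
    by (auto simp: conjugate_norms_on_def bounded_linear_automorphism_on_def)
  let ?S = "inv_into (Lp p) T"
  have "linear_on (Lp p) ?S"
    using Lp_add_mixed_norm(1)[OF a p(1)] Lp_scale[OF p(1)] by (intro linear_on_inv_into T)
  moreover have "bij_betw ?S (Lp p) (Lp p)" using T(2) by (rule bij_betw_inv_into)
  moreover have "mixed_norm p b x = mixed_norm p a (?S x)" if "x \<in> Lp p" for x
    using iso[of "?S x"] that T(2) by (simp add: bij_betw_def inv_into_into f_inv_into_f)
  ultimately have "a \<le> b * DIM('k)" by (rule isometry_dimension_bound[OF b a p])
  moreover have "b \<le> a * DIM('k)" using T iso by (rule isometry_dimension_bound[OF a b p])
  ultimately show False using ab by linarith
qed

text \<open>The type classes are those shared by the real and the complex numbers, so one argument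
  serves both scalar fields.\<close>

lemma infinitely_many_almost_transitive_norms:
  assumes p: "1 \<le> p" "p \<noteq> 2"
  shows "\<exists>N :: nat \<Rightarrow> 'k::{real_normed_field,euclidean_space} L0 \<Rightarrow> real.
    (\<forall>n. norm_on (Lp p) (N n) \<and> equivalent_norms_on (Lp p) (N n) (Lp_norm p) \<and> almost_transitive_on (Lp p) (N n)) \<and>
    (\<forall>n m. n \<noteq> m \<longrightarrow> \<not> conjugate_norms_on (Lp p) (Lp_norm p) (N n) (N m))"
proof (intro exI conjI allI impI)
  \<comment> \<open>Each dimension exceeds the previous one by more than the factor
    \<open>DIM('k)\<close>, so any two of them are far enough apart. Index 0 gives a single piece,
    that is, the usual norm.\<close>
  let ?d = "\<lambda>n::nat. Suc DIM('k) ^ n"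
  have d0: "?d n > 0" for n by simp
  show "norm_on (Lp p) (mixed_norm p (?d n) :: 'k L0 \<Rightarrow> real)" for n by (rule norm_on_mixed_norm[OF d0 p(1)])
  show "equivalent_norms_on (Lp p) (mixed_norm p (?d n) :: 'k L0 \<Rightarrow> real) (Lp_norm p)" for n
    by (rule equivalent_mixed_norm[OF d0 p(1)])
  show "almost_transitive_on (Lp p) (mixed_norm p (?d n) :: 'k L0 \<Rightarrow> real)" for n
    by (rule almost_transitive_mixed_norm[OF d0 p(1)])
  have less: "?d n * DIM('k) < ?d m" if "n < m" for n m
  proof -
    have "?d n * DIM('k) < ?d (Suc n)" by simp
    also have "\<dots> \<le> ?d m" using that by (intro power_increasing) auto
    finally show ?thesis .
  qed
  show "\<not> conjugate_norms_on (Lp p) (Lp_norm p) (mixed_norm p (?d n) :: 'k L0 \<Rightarrow> real) (mixed_norm p (?d m))"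
    if "n \<noteq> m" for n m
    using that less[of n m] less[of m n] by (intro mixed_norm_not_conjugate d0 p) linarith
qed

theorem theorem2p22:
  fixes p :: real
  assumes "1 \<le> p" and "p \<noteq> 2"
  shows "(\<exists>N :: nat \<Rightarrow> real L0 \<Rightarrow> real.
            (\<forall>n. norm_on (Lp p) (N n) \<and>
                 equivalent_norms_on (Lp p) (N n) (Lp_norm p) \<and>
                 almost_transitive_on (Lp p) (N n)) \<and>
            (\<forall>n m. n \<noteq> m \<longrightarrow> \<not> conjugate_norms_on (Lp p) (Lp_norm p) (N n) (N m)))
       \<and> (\<exists>N :: nat \<Rightarrow> complex L0 \<Rightarrow> real.
            (\<forall>n. norm_on (Lp p) (N n) \<and>
                 equivalent_norms_on (Lp p) (N n) (Lp_norm p) \<and>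
                 almost_transitive_on (Lp p) (N n)) \<and>
            (\<forall>n m. n \<noteq> m \<longrightarrow> \<not> conjugate_norms_on (Lp p) (Lp_norm p) (N n) (N m)))"
  using assms by (intro conjI infinitely_many_almost_transitive_norms)

end
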